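(* Let $k\in\mathbb Z_{>0}$ and $n\in\mathbb Z$ with $k\ge n$. Let $V$ be a simple $\mathfrak D^{(0,-n)}$-module of level $\ell\ne0$ such that there exists $l\in\mathbb N$ with: (a) $h_{k-\frac12}$ acts injectively on $V$; (b) $h_{i-\frac12}V=0$ and $d_jV=0$ for all $i>k$ and all $j>l$. Then the induced module $\mathrm{Ind}^{\mathfrak D}_{\mathfrak D^{(0,-n)}}(V)$ is a simple $\mathfrak D$-module if one of the following holds: (1) $k=n$, $l\ge 2n$, and $d_l$ acts injectively on $V$; (2) $k>n$, $k+n\ge 2$, and $l=n+k-1$.
   Context: $\mathfrak D$ is the Lie algebra with basis $\{d_m,h_r,\mathbf c_1,\mathbf c_2:m\in\mathbb Z,r\in\frac12+\mathbb Z\}$ and brackets $[d_m,d_n]=(m-n)d_{m+n}+\delta_{m+n,0}\frac{m^3-m}{12}\mathbf c_1$, $[d_m,h_r]=-rh_{m+r}$, $[h_r,h_s]=r\delta_{r+s,0}\mathbf c_2$, with $\mathbf c_1,\mathbf c_2$ central. For $m\in\mathbb N$, $q\in\mathbb Z$, $\mathfrak D^{(m,q)}=\bigoplus_{i\ge0}(\mathbb Cd_{m+i}\oplus\mathbb Ch_{q+i+1/2})\oplus\mathbb C\mathbf c_1\oplus\mathbb C\mathbf c_2$; so $\mathfrak D^{(0,-n)}$ is spanned by $\mathbf c_1,\mathbf c_2$, $d_i$ ($i\ge0$) and $h_{-n+i+1/2}$ ($i\ge0$). Level $\ell$ means $\mathbf c_2$ acts as $\ell$. $\mathrm{Ind}^{\mathfrak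 D}_{\mathfrak D^{(0,-n)}}(V)=U(\mathfrak D)\otimes_{U(\mathfrak D^{(0,-n)})}V$. $\mathbb N=\{0,1,2,\dots\}$. *)

theory Defs
  imports Complex_Main "HOL-Library.Function_Algebras"
begin

text \<open>Basis elements: Dg m = d_m, Hg i = h_(i - 1/2) (so every r in 1/2 + Z is i - 1/2
  for a unique integer i), C1 = c_1, C2 = c_2.\<close>

datatype gen = Dg int | Hg int | C1 | C2

text \<open>Structure constants: brk x y z is the coefficient of the basis element z in [x,y].\<close>

fun brk :: "gen \<Rightarrow> gen \<Rightarrow> gen \<Rightarrow> complex" where
  "brk (Dg m) (Dg n) z =
     (if z = Dg (m + n) then of_int (m - n) else 0)
   + (if z = C1 \<and> m + n = 0 then of_int (m ^ 3 - m) / 12 else 0)"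
| "brk (Dg m) (Hg i) z = (if z = Hg (m + i) then - (of_int i - 1/2) else 0)"
| "brk (Hg i) (Dg m) z = (if z = Hg (m + i) then of_int i - 1/2 else 0)"
| "brk (Hg i) (Hg j) z = (if z = C2 \<and> i + j = 1 then of_int i - 1/2 else 0)"
| "brk _ _ z = 0"

text \<open>Basis of the subalgebra D^(0,-n): c_1, c_2, d_m (m \<ge> 0), h_r (r \<ge> -n + 1/2).\<close>

fun in_Dsub :: "int \<Rightarrow> gen \<Rightarrow> bool" where
  "in_Dsub n (Dg m) = (m \<ge> 0)"
| "in_Dsub n (Hg i) = (i \<ge> 1 - n)"
| "in_Dsub n C1 = True"
| "in_Dsub n C2 = True"

definition brk_act :: "(complex \<Rightarrow> 'v \<Rightarrow> 'v) \<Rightarrow> (gen \<Rightarrow> 'v \<Rightarrow> 'v) \<Rightarrow> gen \<Rightarrow> gen \<Rightarrow> 'v \<Rightarrow> 'v::ab_group_add"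
  where "brk_act sc rho x y v = (\<Sum>z\<in>{z. brk x y z \<noteq> 0}. sc (brk x y z) (rho z v))"

definition Dsub_module :: "int \<Rightarrow> (complex \<Rightarrow> 'v \<Rightarrow> 'v) \<Rightarrow> (gen \<Rightarrow> 'v \<Rightarrow> 'v::ab_group_add) \<Rightarrow> bool" where
  "Dsub_module n sc rho \<longleftrightarrow>
     vector_space sc \<and>
     (\<forall>x. in_Dsub n x \<longrightarrow> Vector_Spaces.linear sc sc (rho x)) \<and>
     (\<forall>x y v. in_Dsub n x \<longrightarrow> in_Dsub n y \<longrightarrow>
        rho x (rho y v) - rho y (rho x v) = brk_act sc rho x y v)"

definition simple_Dsub_module :: "int \<Rightarrow> (complex \<Rightarrow> 'v \<Rightarrow> 'v) \<Rightarrow> (gen \<Rightarrow> 'v \<Rightarrow> 'v::ab_group_add) \<Rightarrow> bool" where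
  "simple_Dsub_module n sc rho \<longleftrightarrow>
     Dsub_module n sc rho \<and> (UNIV :: 'v set) \<noteq> {0} \<and>
     (\<forall>W. module.subspace sc W \<longrightarrow> (\<forall>x. in_Dsub n x \<longrightarrow> rho x ` W \<subseteq> W) \<longrightarrow>
          W = {0} \<or> W = UNIV)"

text \<open>Construction: take the free vector space on pairs (w, v), w a word in the basis of D
  (i.e. a monomial of the tensor algebra T(D)) and v \<in> V, realised as finitely supported
  functions (gen list \<times> 'v) \<Rightarrow> complex.  Quotient by the subspace spanned by
  (i) linearity in v, (ii) the relations u(xy - yx - [x,y])t of U(D),
  (iii) w p \<otimes> v = w \<otimes> p.v for p a basis element of D^(0,-n).
  D acts by left multiplication of words.\<close>

definition fscale :: "complex \<Rightarrow> ('a \<Rightarrow> complex) \<Rightarrow> ('a \<Rightarrow> complex)" where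
  "fscale c f = (\<lambda>a. c * f a)"

definition delta :: "gen list \<Rightarrow> 'v \<Rightarrow> (gen list \<times> 'v \<Rightarrow> complex)" where
  "delta w v = (\<lambda>p. if p = (w, v) then 1 else 0)"

definition free_space :: "(gen list \<times> 'v \<Rightarrow> complex) set" where
  "free_space = module.span fscale {delta w v | w v. True}"

definition ind_relations :: "int \<Rightarrow> (complex \<Rightarrow> 'v \<Rightarrow> 'v) \<Rightarrow> (gen \<Rightarrow> 'v \<Rightarrow> 'v::ab_group_add)
    \<Rightarrow> (gen list \<times> 'v \<Rightarrow> complex) set" where
  "ind_relations n sc rho =
     {delta w (sc a v + sc b v') - fscale a (delta w v) - fscale b (delta w v') | w a b v v'. True}
   \<union> {delta (u @ [x, y] @ t) v - delta (u @ [y, x] @ t) v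
        - (\<Sum>z\<in>{z. brk x y z \<noteq> 0}. fscale (brk x y z) (delta (u @ [z] @ t) v)) | u x y t v. True}
   \<union> {delta (w @ [p]) v - delta w (rho p v) | w p v. in_Dsub n p}"

definition ind_kernel :: "int \<Rightarrow> (complex \<Rightarrow> 'v \<Rightarrow> 'v) \<Rightarrow> (gen \<Rightarrow> 'v \<Rightarrow> 'v::ab_group_add)
    \<Rightarrow> (gen list \<times> 'v \<Rightarrow> complex) set" where
  "ind_kernel n sc rho = module.span fscale (ind_relations n sc rho)"

definition lmult :: "gen \<Rightarrow> (gen list \<times> 'v \<Rightarrow> complex) \<Rightarrow> (gen list \<times> 'v \<Rightarrow> complex)" where
  "lmult x f = (\<lambda>(w, v). case w of [] \<Rightarrow> 0 | y # w' \<Rightarrow> if y = x then f (w', v) else 0)"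

text \<open>The induced module free_space / ind_kernel is a simple D-module: it is nonzero and
  its only D-submodules are 0 and itself, i.e. the only D-stable subspaces S with
  ind_kernel \<subseteq> S \<subseteq> free_space are ind_kernel and free_space.\<close>

definition induced_module_simple :: "int \<Rightarrow> (complex \<Rightarrow> 'v \<Rightarrow> 'v) \<Rightarrow> (gen \<Rightarrow> 'v \<Rightarrow> 'v::ab_group_add) \<Rightarrow> bool" where
  "induced_module_simple n sc rho \<longleftrightarrow>
     ind_kernel n sc rho \<noteq> free_space \<and>
     (\<forall>S. module.subspace fscale S \<longrightarrow> ind_kernel n sc rho \<subseteq> S \<longrightarrow> S \<subseteq> free_space \<longrightarrow>
          (\<forall>x. lmult x ` S \<subseteq> S) \<longrightarrow> S = ind_kernel n sc rho \<or> S = free_space)"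

end

theory Submission
  imports Defs "HOL-Library.Multiset"
begin

text \<open>
  Write \<open>H\<^sub>i = h\<^sub>i\<^sub>-\<^sub>1\<^sub>/\<^sub>2\<close>, and let \<open>Y\<^sub>a = d\<^sub>-\<^sub>a\<close> and
  \<open>X\<^sub>a = H\<^sub>1\<^sub>-\<^sub>n\<^sub>-\<^sub>a\<close> (\<open>a \<ge> 1\<close>) be the basis elements outside the subalgebra. Give both
  the weight \<open>2a + 1\<close> and filter the induced module by the total weight of words in them applied
  to \<open>V\<close>. The summand \<open>1\<close> makes every commutator of such elements drop in the
  filtration, so leading terms are commutative polynomials with coefficients in \<open>V\<close>. The elements
  \<open>H\<^sub>k\<^sub>+\<^sub>a\<close> and \<open>d\<^sub>l\<^sub>+\<^sub>a\<close> kill \<open>V\<close>, lower the filtration by \<open>2a + 1\<close>, and act on leading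
  terms, up to nonzero scalars on each summand, as

    \<open>H\<^sub>k \<partial>/\<partial>Y\<^sub>a + [k = n] c\<^sub>2 \<partial>/\<partial>X\<^sub>a\<close>  and
    \<open>d\<^sub>l \<partial>/\<partial>Y\<^sub>a + [l = n + k - 1] H\<^sub>k \<partial>/\<partial>X\<^sub>a\<close>.

  In either case of the theorem one of them removes a variable \<open>Y\<^sub>a\<close> injectively, and
  the other removes \<open>X\<^sub>a\<close> once no \<open>Y\<close> is left; hence every nonzero submodule
  meets \<open>V\<close>, and simplicity of \<open>V\<close> finishes the argument. The induced module is nonzero by
  the Poincare-Birkhoff-Witt theorem, in the form of a confluence argument for the projection of the
  induced module onto \<open>V\<close>.
\<close>

section \<open>The projection of an induced module onto the inducing module\<close>

text \<open>The sign of \<open>rk\<close> encodes the subalgebra, whose basis consists of the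
  elements of rank at least 0. Injectivity makes \<open>rk\<close> a total order on the whole basis,
  along which words are sorted.\<close>

locale based_lie_subalgebra_module = vector_space sc
  for sc :: "complex \<Rightarrow> 'v::ab_group_add \<Rightarrow> 'v" +
  fixes br :: "'g \<Rightarrow> 'g \<Rightarrow> 'g \<Rightarrow> complex"
    and rk :: "'g \<Rightarrow> int"
    and rho :: "'g \<Rightarrow> 'v \<Rightarrow> 'v"
  assumes inj_rk: "inj rk"
    and finite_br: "finite {z. br x y z \<noteq> 0}"
    and br_antisym: "br y x z = - br x y z"
    and br_jacobi: "(\<Sum>z\<in>{z. br x y z \<noteq> 0}. br x y z * br z t w)
      + (\<Sum>z\<in>{z. br y t z \<noteq> 0}. br y t z * br z x w)
      + (\<Sum>z\<in>{z. br t x z \<noteq> 0}. br t x z * br z y w) = 0"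
    and br_closed: "0 \<le> rk x \<Longrightarrow> 0 \<le> rk y \<Longrightarrow> br x y z \<noteq> 0 \<Longrightarrow> 0 \<le> rk z"
    and rho_linear: "0 \<le> rk x \<Longrightarrow> Vector_Spaces.linear sc sc (rho x)"
    and rho_br: "0 \<le> rk x \<Longrightarrow> 0 \<le> rk y \<Longrightarrow>
      rho x (rho y v) - rho y (rho x v) = (\<Sum>z\<in>{z. br x y z \<noteq> 0}. sc (br x y z) (rho z v))"
begin

text \<open>This is the linear extension of \<open>f\<close> evaluated at [x, y]; identities between
  brackets become identities between such sums.\<close>

definition bsum :: "'g \<Rightarrow> 'g \<Rightarrow> ('g \<Rightarrow> 'v) \<Rightarrow> 'v" where
  "bsum x y f = (\<Sum>z\<in>{z. br x y z \<noteq> 0}. sc (br x y z) (f z))"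

lemma bsum_eq: "finite Z \<Longrightarrow> {z. br x y z \<noteq> 0} \<subseteq> Z \<Longrightarrow> bsum x y f = (\<Sum>z\<in>Z. sc (br x y z) (f z))"
  unfolding bsum_def by (rule sum.mono_neutral_left) auto

lemma bsum_cong: "(\<And>z. br x y z \<noteq> 0 \<Longrightarrow> f z = g z) \<Longrightarrow> bsum x y f = bsum x y g"
  unfolding bsum_def by (rule sum.cong) auto

lemma bsum_add: "bsum x y (\<lambda>z. f z + g z) = bsum x y f + bsum x y g"
  by (simp add: bsum_def scale_right_distrib sum.distrib)

lemma bsum_diff: "bsum x y (\<lambda>z. f z - g z) = bsum x y f - bsum x y g"
  by (simp add: bsum_def scale_right_diff_distrib sum_subtractf)

lemma bsum_scale: "bsum x y (\<lambda>z. sc a (f z)) = sc a (bsum x y f)"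
  by (simp add: bsum_def scale_sum_right mult.commute)

lemma bsum_swap: "bsum x y f = - bsum y x f"
proof -
  have "{z. br x y z \<noteq> 0} = {z. br y x z \<noteq> 0}"
    using br_antisym[of x y] by auto
  then show ?thesis
    by (simp add: bsum_def br_antisym[of x y] sum_negf)
qed

lemma bsum_self [simp]: "bsum x x f = 0"
proof -
  have "br x x z = 0" for z
    using br_antisym[of x x z] by simp
  then show ?thesis
    by (simp add: bsum_def)
qed

lemma bsum_commute:
  "bsum x y (\<lambda>z. bsum x' y' (f z)) = bsum x' y' (\<lambda>z'. bsum x y (\<lambda>z. f z z'))"
  unfolding bsum_def scale_sum_right
  by (subst sum.swap) (simp add: mult.commute)

lemma bsum_jacobi:
  "bsum x y (\<lambda>z. bsum z t f) + bsum y t (\<lambda>z. bsum z x f) + bsum t x (\<lambda>z. bsum z y f) = 0"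
proof -
  \<comment> \<open>\<open>W\<close> is a finite set containing the supports of all the double
    brackets, so that the coefficient of each \<open>f w\<close> can be collected and is a Jacobi
    sum.\<close>
  define W where "W = (\<Union>z\<in>{z. br x y z \<noteq> 0}. {w. br z t w \<noteq> 0})
    \<union> (\<Union>z\<in>{z. br y t z \<noteq> 0}. {w. br z x w \<noteq> 0})
    \<union> (\<Union>z\<in>{z. br t x z \<noteq> 0}. {w. br z y w \<noteq> 0})"
  have W: "finite W"
    unfolding W_def using finite_br by auto
  have eq: "bsum a b (\<lambda>z. bsum z c f)
      = (\<Sum>w\<in>W. sc (\<Sum>z\<in>{z. br a b z \<noteq> 0}. br a b z * br z c w) (f w))"
    if "\<And>z. br a b z \<noteq> 0 \<Longrightarrow> {w. br z c w \<noteq> 0} \<subseteq> W" for a b c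
  proof -
    have "bsum a b (\<lambda>z. bsum z c f) = bsum a b (\<lambda>z. \<Sum>w\<in>W. sc (br z c w) (f w))"
      using bsum_eq[OF W that] by (intro bsum_cong) auto
    also have "\<dots> = (\<Sum>w\<in>W. \<Sum>z\<in>{z. br a b z \<noteq> 0}. sc (br a b z * br z c w) (f w))"
      unfolding bsum_def scale_sum_right by (subst sum.swap) simp
    finally show ?thesis
      by (simp add: scale_sum_left)
  qed
  have "bsum x y (\<lambda>z. bsum z t f) + bsum y t (\<lambda>z. bsum z x f) + bsum t x (\<lambda>z. bsum z y f)
    = (\<Sum>w\<in>W. sc ((\<Sum>z\<in>{z. br x y z \<noteq> 0}. br x y z * br z t w)
      + (\<Sum>z\<in>{z. br y t z \<noteq> 0}. br y t z * br z x w)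
      + (\<Sum>z\<in>{z. br t x z \<noteq> 0}. br t x z * br z y w)) (f w))"
    by (subst (1 2 3) eq) (auto simp: W_def scale_left_distrib sum.distrib)
  also have "\<dots> = 0"
    by (simp add: br_jacobi)
  finally show ?thesis .
qed

section \<open>Sorting words by rank\<close>

fun inversions :: "'g list \<Rightarrow> nat" where
  "inversions [] = 0"
| "inversions (x # xs) = length (filter (\<lambda>y. rk y < rk x) xs) + inversions xs"

lemma inversions_swap:
  "rk y < rk x \<Longrightarrow> inversions (u @ y # x # t) < inversions (u @ x # y # t)"
  by (induction u) auto

text \<open>Straightening xy into yx keeps the length and removes an inversion, while a term of
  [x, y] shortens the word; comparing lengths first makes both decrease.\<close>

definition word_order :: "('g list \<times> 'g list) set" where
  "word_order = measures [length, inversions]"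

lemma wf_word_order: "wf word_order"
  by (simp add: word_order_def)

lemma word_order_shorter: "length w < length w' \<Longrightarrow> (w, w') \<in> word_order"
  by (simp add: word_order_def)

lemma word_order_swap: "rk y < rk x \<Longrightarrow> (u @ y # x # t, u @ x # y # t) \<in> word_order"
  using inversions_swap by (simp add: word_order_def)

definition descent :: "'g list \<Rightarrow> 'g list \<times> 'g \<times> 'g \<times> 'g list \<Rightarrow> bool" where
  "descent w = (\<lambda>(u, x, y, t). w = u @ x # y # t \<and> rk y < rk x)"

text \<open>This is the projection of w \<otimes> v to V along the sorted monomials with a nonempty
  raising part. Sorting makes ranks increase, so letters of the subalgebra end up on the right and
  act on \<open>v\<close>; a sorted word ending in a negative rank contributes 0. The descent is
  picked by \<open>SOME\<close>; that every other descent gives the same value is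
  \<open>psi_descent\<close>.\<close>

function psi :: "'g list \<Rightarrow> 'v \<Rightarrow> 'v" where
  "psi w v = (if Ex (descent w) then
       (case SOME q. descent w q of (u, x, y, t) \<Rightarrow>
          psi (u @ y # x # t) v
          + (\<Sum>z\<in>{z. br x y z \<noteq> 0}. sc (br x y z) (psi (u @ z # t) v)))
     else if w = [] then v
     else if 0 \<le> rk (last w) then psi (butlast w) (rho (last w) v) else 0)"
  by pat_completeness auto
termination
proof (relation "inv_image word_order fst")
  show "wf (inv_image word_order fst)"
    by (simp add: wf_word_order)
next
  fix w :: "'g list" and v :: 'v and u x y t p q
  assume "Ex (descent w)"
    and q: "(u, p) = (SOME q. descent w q)" "(x, q) = p" "(y, t) = q"
  then have "descent w (u, x, y, t)"
    by (metis someI_ex)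
  then show "((u @ y # x # t, v), w, v) \<in> inv_image word_order fst"
    by (auto simp: descent_def word_order_swap)
next
  fix w :: "'g list" and v :: 'v and u x y t p q z
  assume "Ex (descent w)"
    and q: "(u, p) = (SOME q. descent w q)" "(x, q) = p" "(y, t) = q"
  then have "descent w (u, x, y, t)"
    by (metis someI_ex)
  then show "((u @ z # t, v), w, v) \<in> inv_image word_order fst"
    by (auto simp: descent_def intro!: word_order_shorter)
qed (auto intro!: word_order_shorter)

declare psi.simps [simp del]

lemma psi_Nil [simp]: "psi [] v = v"
  by (subst psi.simps) (auto simp: descent_def)

section \<open>Confluence of the sorting\<close>

definition reduct :: "'g list \<Rightarrow> 'g \<Rightarrow> 'g \<Rightarrow> 'g list \<Rightarrow> 'v \<Rightarrow> 'v" where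
  "reduct u x y t v = psi (u @ y # x # t) v + bsum x y (\<lambda>z. psi (u @ z # t) v)"

lemma psi_reduct_some:
  assumes "descent w q0"
  obtains u x y t where "w = u @ x # y # t" "rk y < rk x" "\<And>v. psi w v = reduct u x y t v"
proof -
  obtain u x y t where q: "(SOME q. descent w q) = (u, x, y, t)"
    by (metis prod.collapse)
  then have "descent w (u, x, y, t)"
    using assms by (metis someI)
  moreover have "psi w v = reduct u x y t v" for v
  proof -
    have "Ex (descent w)"
      using assms by blast
    then show ?thesis
      using q by (subst psi.simps) (simp add: reduct_def bsum_def)
  qed
  ultimately show thesis
    by (auto simp: descent_def intro: that)
qed

lemma psi_sorted:
  assumes "\<not> Ex (descent (w @ [p]))" "0 \<le> rk p"
  shows "psi (w @ [p]) v = psi w (rho p v)"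
  using assms by (subst psi.simps) auto

text \<open>The rule for descents is a hypothesis because inside the confluence proof it is
  available only for smaller words. An ascending pair is the mirror image of a descent by
  antisymmetry, and equal ranks force x = y.\<close>

lemma psi_exchange_of_descents:
  assumes desc: "\<And>x y. rk y < rk x \<Longrightarrow> psi (u @ x # y # t) v = reduct u x y t v"
  shows "psi (u @ x # y # t) v - psi (u @ y # x # t) v = bsum x y (\<lambda>z. psi (u @ z # t) v)"
proof (cases "rk x" "rk y" rule: linorder_cases)
  case less
  then show ?thesis
    using desc[OF less] bsum_swap[of x y] by (simp add: reduct_def)
next
  case equal
  then have "x = y"
    using inj_rk by (auto dest: injD)
  then show ?thesis by simp
next
  case greater
  then show ?thesis
    using desc[OF greater] by (simp add: reduct_def)
qed

text \<open>After either reduction the other descent is still present and can be reduced as well.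
  Both orders give the same terms, the one with two brackets because the two sums commute.\<close>

lemma reduct_confluent_disjoint:
  assumes IH: "\<And>w' u x y t. (w', u1 @ x1 # y1 # s @ x2 # y2 # t2) \<in> word_order \<Longrightarrow>
      w' = u @ x # y # t \<Longrightarrow> rk y < rk x \<Longrightarrow> psi w' v = reduct u x y t v"
    and r1: "rk y1 < rk x1" and r2: "rk y2 < rk x2"
  shows "reduct u1 x1 y1 (s @ x2 # y2 # t2) v = reduct (u1 @ x1 # y1 # s) x2 y2 t2 v"
proof -
  let ?w = "u1 @ x1 # y1 # s @ x2 # y2 # t2"
  have 1: "psi (u1 @ y1 # x1 # s @ x2 # y2 # t2) v = reduct (u1 @ y1 # x1 # s) x2 y2 t2 v"
    by (rule IH) (use word_order_swap[OF r1] r2 in auto)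
  have "((u1 @ x1 # y1 # s) @ y2 # x2 # t2, ?w) \<in> word_order"
    using word_order_swap[OF r2, of "u1 @ x1 # y1 # s" t2] by simp
  then have 2: "psi ((u1 @ x1 # y1 # s) @ y2 # x2 # t2) v = reduct u1 x1 y1 (s @ y2 # x2 # t2) v"
    by (rule IH) (use r1 in auto)
  have 3: "psi (u1 @ z # s @ x2 # y2 # t2) v = reduct (u1 @ z # s) x2 y2 t2 v" for z
    by (rule IH) (use r2 in \<open>auto intro!: word_order_shorter\<close>)
  have 4: "psi ((u1 @ x1 # y1 # s) @ z # t2) v = reduct u1 x1 y1 (s @ z # t2) v" for z
    by (rule IH) (use r1 in \<open>auto intro!: word_order_shorter\<close>)
  have "reduct u1 x1 y1 (s @ x2 # y2 # t2) v
      = reduct (u1 @ y1 # x1 # s) x2 y2 t2 v + bsum x1 y1 (\<lambda>z. reduct (u1 @ z # s) x2 y2 t2 v)"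
    using 1 3 by (simp add: reduct_def)
  moreover have "reduct (u1 @ x1 # y1 # s) x2 y2 t2 v
      = reduct u1 x1 y1 (s @ y2 # x2 # t2) v + bsum x2 y2 (\<lambda>z. reduct u1 x1 y1 (s @ z # t2) v)"
    unfolding reduct_def[of "u1 @ x1 # y1 # s"] 2 4 ..
  ultimately show ?thesis
    by (simp add: reduct_def bsum_add bsum_commute[of x1 y1 x2 y2] algebra_simps)
qed

text \<open>Both ways of sorting the decreasing triple a b c end in c b a, so these words cancel.
  The leftover terms pair up by the exchange rule, known for words one letter shorter, into the
  double brackets of the Jacobi identity.\<close>

lemma reduct_confluent_overlap:
  assumes IH: "\<And>w' u x y t. (w', u1 @ a # b # c # t1) \<in> word_order \<Longrightarrow>
      w' = u @ x # y # t \<Longrightarrow> rk y < rk x \<Longrightarrow> psi w' v = reduct u x y t v"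
    and r1: "rk b < rk a" and r2: "rk c < rk b"
  shows "reduct u1 a b (c # t1) v = reduct (u1 @ [a]) b c t1 v"
proof -
  let ?w = "u1 @ a # b # c # t1"
  have o1: "(u1 @ b # a # c # t1, ?w) \<in> word_order"
    using word_order_swap[OF r1] .
  have o2: "(u1 @ a # c # b # t1, ?w) \<in> word_order"
    using word_order_swap[OF r2, of "u1 @ [a]" t1] by simp
  have r3: "rk c < rk a"
    using r1 r2 by simp
  have o3: "(u1 @ b # c # a # t1, ?w) \<in> word_order"
    using o1 word_order_swap[OF r3, of "u1 @ [b]" t1]
    by (auto simp: word_order_def)
  have o4: "(u1 @ c # a # b # t1, ?w) \<in> word_order"
    using o2 word_order_swap[OF r3, of "u1" "b # t1"]
    by (auto simp: word_order_def)
  have 1: "psi (u1 @ b # a # c # t1) v = reduct (u1 @ [b]) a c t1 v"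
    by (rule IH[OF o1]) (use r3 in auto)
  have 2: "psi (u1 @ b # c # a # t1) v = reduct u1 b c (a # t1) v"
    by (rule IH[OF o3]) (use r2 in auto)
  have 3: "psi (u1 @ a # c # b # t1) v = reduct u1 a c (b # t1) v"
    by (rule IH[OF o2]) (use r3 in auto)
  have 4: "psi (u1 @ c # a # b # t1) v = reduct (u1 @ [c]) a b t1 v"
    by (rule IH[OF o4]) (use r1 in auto)
  have ex: "psi (u1 @ x # y # t1) v - psi (u1 @ y # x # t1) v
      = bsum x y (\<lambda>z. psi (u1 @ z # t1) v)" for x y
    by (rule psi_exchange_of_descents, rule IH) (auto intro!: word_order_shorter)
  let ?P = "\<lambda>x y. psi (u1 @ x # y # t1) v"
  have "reduct u1 a b (c # t1) v - reduct (u1 @ [a]) b c t1 v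
     = bsum a b (\<lambda>z. ?P z c) - bsum a b (\<lambda>z. ?P c z)
     + (bsum b c (\<lambda>z. ?P z a) - bsum b c (\<lambda>z. ?P a z))
     - (bsum a c (\<lambda>z. ?P z b) - bsum a c (\<lambda>z. ?P b z))"
    using 1 2 3 4 by (simp add: reduct_def)
  also have "\<dots> = bsum a b (\<lambda>z. ?P z c - ?P c z) + bsum b c (\<lambda>z. ?P z a - ?P a z)
     + bsum c a (\<lambda>z. ?P z b - ?P b z)"
    unfolding bsum_swap[of c a] by (simp add: bsum_diff)
  also have "\<dots> = 0"
    unfolding ex by (rule bsum_jacobi)
  finally show ?thesis by simp
qed

lemma reduct_confluent:
  assumes IH: "\<And>w' u x y t. (w', w) \<in> word_order \<Longrightarrow>
      w' = u @ x # y # t \<Longrightarrow> rk y < rk x \<Longrightarrow> psi w' v = reduct u x y t v"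
    and w1: "w = u1 @ x1 # y1 # t1" "rk y1 < rk x1"
    and w2: "w = u2 @ x2 # y2 # t2" "rk y2 < rk x2"
    and le: "length u1 \<le> length u2"
  shows "reduct u1 x1 y1 t1 v = reduct u2 x2 y2 t2 v"
proof -
  obtain s where s: "u2 = u1 @ s" "x1 # y1 # t1 = s @ x2 # y2 # t2"
  proof
    have "u1 = take (length u1) (u2 @ x2 # y2 # t2)"
      using w1(1) w2(1) by (metis append_eq_conv_conj)
    then have "u1 = take (length u1) u2"
      using le by simp
    then show u2: "u2 = u1 @ drop (length u1) u2"
      by (metis append_take_drop_id)
    then show "x1 # y1 # t1 = drop (length u1) u2 @ x2 # y2 # t2"
      using w1(1) w2(1) by (metis append_assoc same_append_eq)
  qed
  \<comment> \<open>\<open>s\<close> separates the starts of the two descents: it is empty if they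
    coincide, one letter if they overlap, and longer if they are disjoint.\<close>
  consider "s = []" | "s = [x1]" | s' where "s = x1 # y1 # s'"
    using s(2) by (cases s; cases "tl s") auto
  then show ?thesis
  proof cases
    case 1
    then show ?thesis using s by simp
  next
    case 2
    then have "y1 = x2" "t1 = y2 # t2"
      using s by auto
    moreover have "reduct u1 x1 x2 (y2 # t2) v = reduct (u1 @ [x1]) x2 y2 t2 v"
      by (rule reduct_confluent_overlap, rule IH) (use w1 w2 calculation in auto)
    ultimately show ?thesis using 2 s by simp
  next
    case 3
    then have "t1 = s' @ x2 # y2 # t2"
      using s by auto
    moreover have "reduct u1 x1 y1 (s' @ x2 # y2 # t2) v = reduct (u1 @ x1 # y1 # s') x2 y2 t2 v"
      by (rule reduct_confluent_disjoint, rule IH) (use w1 w2 calculation in auto)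
    ultimately show ?thesis using 3 s by simp
  qed
qed

text \<open>A diamond lemma argument: well-founded induction compares the given descent with the one
  picked by \<open>SOME\<close>, and \<open>reduct_confluent\<close> is applied with the left one
  first.\<close>

lemma psi_descent: "w = u @ x # y # t \<Longrightarrow> rk y < rk x \<Longrightarrow> psi w v = reduct u x y t v"
proof (induction w arbitrary: u x y t rule: wf_induct_rule[OF wf_word_order])
  case (1 w)
  then have "descent w (u, x, y, t)"
    by (simp add: descent_def)
  then obtain u' x' y' t' where w': "w = u' @ x' # y' # t'" "rk y' < rk x'"
    and eq: "psi w v = reduct u' x' y' t' v"
    by (metis psi_reduct_some)
  have "reduct u' x' y' t' v = reduct u x y t v"
  proof (cases "length u' \<le> length u")
    case True
    then show ?thesis
      using reduct_confluent[OF 1(1) w' 1(2,3)] by blast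
  next
    case False
    then show ?thesis
      using reduct_confluent[OF 1(1) 1(2,3) w'] by (metis nat_le_linear)
  qed
  with eq show ?case by simp
qed

section \<open>Compatibility of the projection with the defining relations\<close>

lemma psi_exchange:
  "psi (u @ x # y # t) v - psi (u @ y # x # t) v = bsum x y (\<lambda>z. psi (u @ z # t) v)"
  by (rule psi_exchange_of_descents) (rule psi_descent, auto)

lemma psi_linear: "psi w (sc a v + sc b v') = sc a (psi w v) + sc b (psi w v')"
proof (induction w arbitrary: v v' rule: wf_induct_rule[OF wf_word_order])
  case (1 w)
  show ?case
  proof (cases "Ex (descent w)")
    case True
    then obtain u x y t where w: "w = u @ x # y # t" "rk y < rk x"
      and eq: "\<And>v. psi w v = reduct u x y t v"
      by (metis psi_reduct_some)
    have "psi (u @ y # x # t) (sc a v + sc b v')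
        = sc a (psi (u @ y # x # t) v) + sc b (psi (u @ y # x # t) v')"
      using 1[of "u @ y # x # t"] w word_order_swap by blast
    moreover have "psi (u @ z # t) (sc a v + sc b v')
        = sc a (psi (u @ z # t) v) + sc b (psi (u @ z # t) v')" for z
      by (rule 1) (simp add: w word_order_shorter)
    ultimately show ?thesis
      by (simp add: eq reduct_def bsum_add bsum_scale scale_right_distrib)
  next
    case False
    show ?thesis
    proof (cases "w \<noteq> [] \<and> 0 \<le> rk (last w)")
      case True
      interpret r: Vector_Spaces.linear sc sc "rho (last w)"
        using rho_linear True by blast
      have "psi (butlast w) (sc a (rho (last w) v) + sc b (rho (last w) v'))
        = sc a (psi (butlast w) (rho (last w) v)) + sc b (psi (butlast w) (rho (last w) v'))"
        using 1[of "butlast w"] True by (simp add: word_order_shorter)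
      then show ?thesis
        using True False by (subst (1 2 3) psi.simps) (simp add: r.add r.scale)
    next
      case not: False
      then show ?thesis
        using False by (subst (1 2 3) psi.simps) auto
    qed
  qed
qed

lemma psi_add: "psi w (v + v') = psi w v + psi w v'"
  using psi_linear[of w 1 v 1 v'] by simp

lemma psi_scale: "psi w (sc a v) = sc a (psi w v)"
  using psi_linear[of w a v 0 0] by simp

lemma psi_sum: "psi w (\<Sum>z\<in>Z. f z) = (\<Sum>z\<in>Z. psi w (f z))"
proof (induction Z rule: infinite_finite_induct)
  case empty
  show ?case using psi_scale[of w 0 0] by simp
qed (use psi_scale[of w 0 0] in \<open>simp_all add: psi_add\<close>)

text \<open>A descent further left leaves \<open>p\<close> in place and is reduced on both sides. If
  the descent is x p at the end, then x has larger rank and lies in the subalgebra too; the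
  reduction matches \<open>rho_br\<close>, and \<open>br_closed\<close> lets every term of [x, p]
  act on V.\<close>

lemma psi_snoc: "0 \<le> rk p \<Longrightarrow> psi (w @ [p]) v = psi w (rho p v)"
proof (induction "w @ [p]" arbitrary: w p v rule: wf_induct_rule[OF wf_word_order])
  case (1 w p)
  note IH = 1(1)
  show ?case
  proof (cases "Ex (descent (w @ [p]))")
    case False
    then show ?thesis
      using psi_sorted 1 by blast
  next
    case True
    then obtain u x y t where w: "w @ [p] = u @ x # y # t" "rk y < rk x"
      and eq: "\<And>v. psi (w @ [p]) v = reduct u x y t v"
      by (metis psi_reduct_some)
    show ?thesis
    proof (cases t rule: rev_cases)
      case Nil
      then have [simp]: "w = u @ [x]" "y = p"
        using w by auto
      have x: "0 \<le> rk x"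
        using w(2) 1 by simp
      have "psi ((u @ [p]) @ [x]) v = psi (u @ [p]) (rho x v)"
        by (rule IH) (use word_order_swap[OF w(2), of u "[]"] x in auto)
      also have "\<dots> = psi u (rho p (rho x v))"
        by (rule IH) (use 1(2) in \<open>auto intro!: word_order_shorter\<close>)
      finally have a: "psi (u @ [p, x]) v = psi u (rho p (rho x v))"
        by simp
      have "bsum x p (\<lambda>z. psi (u @ [z]) v) = bsum x p (\<lambda>z. psi u (rho z v))"
        by (rule bsum_cong, rule IH)
          (use br_closed[OF x 1(2)] in \<open>auto intro!: word_order_shorter\<close>)
      also have "\<dots> = psi u (bsum x p (\<lambda>z. rho z v))"
        by (simp add: bsum_def psi_sum psi_scale)
      also have "\<dots> = psi u (rho x (rho p v) - rho p (rho x v))"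
        using rho_br[OF x 1(2)] by (simp add: bsum_def)
      finally have "reduct u x y t v = psi u (rho x (rho p v))"
        using Nil a psi_add[of u "rho x (rho p v) - rho p (rho x v)" "rho p (rho x v)"]
        by (simp add: reduct_def add.commute)
      moreover have "psi w (rho p v) = psi u (rho x (rho p v))"
        unfolding \<open>w = u @ [x]\<close> by (rule IH) (use x in \<open>auto intro!: word_order_shorter\<close>)
      ultimately show ?thesis
        by (simp only: eq)
    next
      case (snoc t' q)
      then have [simp]: "w = u @ x # y # t'" "q = p"
        using w(1) by (metis append_Cons append_assoc last_snoc butlast_snoc)+
      have "psi ((u @ y # x # t') @ [p]) v = psi (u @ y # x # t') (rho p v)"
        by (rule IH) (use word_order_swap[OF w(2), of u "t' @ [p]"] 1(2) in auto)
      moreover have "psi ((u @ z # t') @ [p]) v = psi (u @ z # t') (rho p v)" for z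
        by (rule IH) (use 1(2) in \<open>auto intro!: word_order_shorter\<close>)
      ultimately have "reduct u x y t v = reduct u x y t' (rho p v)"
        using snoc by (simp add: reduct_def)
      then show ?thesis
        using psi_descent[OF \<open>w = u @ x # y # t'\<close> w(2)] by (simp only: eq)
    qed
  qed
qed

end

section \<open>The Lie algebra and its induced modules\<close>

lemma finite_brk [simp]: "finite {z. brk x y z \<noteq> 0}"
proof -
  have "{z. brk x y z \<noteq> 0} \<subseteq> (case (x, y) of
      (Dg m, Dg n) \<Rightarrow> {Dg (m + n), C1} | (Dg m, Hg i) \<Rightarrow> {Hg (m + i)}
    | (Hg i, Dg m) \<Rightarrow> {Hg (m + i)} | _ \<Rightarrow> {C2})"
    by (cases x; cases y) (auto split: if_splits)
  moreover have "finite \<dots>"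
    by (cases x; cases y) auto
  ultimately show ?thesis
    by (rule finite_subset)
qed

lemma brk_antisym: "brk y x z = - brk x y z"
proof (cases x; cases y)
  fix m n assume "x = Dg m" "y = Dg n"
  then show ?thesis
    by (cases "n = - m") (auto simp: add.commute add_eq_0_iff field_simps)
next
  fix i j assume "x = Hg i" "y = Hg j"
  moreover have "complex_of_int i = 1 - of_int j" if "i + j = 1"
    using that by (metis of_int_1 of_int_diff add_diff_cancel_right')
  ultimately show ?thesis
    by (auto simp: add.commute)
qed (auto simp: add.commute)

text \<open>With \<open>f\<close> arbitrary, these evaluate the sums of the Jacobi identity, which
  becomes a polynomial identity in the indices.\<close>

lemma sum_brk:
  "(\<Sum>z\<in>{z. brk (Dg m) (Dg n) z \<noteq> 0}. brk (Dg m) (Dg n) z * f z)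
     = of_int (m - n) * f (Dg (m + n)) + (if m + n = 0 then of_int (m ^ 3 - m) / 12 * f C1 else 0)"
  "(\<Sum>z\<in>{z. brk (Dg m) (Hg i) z \<noteq> 0}. brk (Dg m) (Hg i) z * f z)
     = - (of_int i - 1/2) * f (Hg (m + i))"
  "(\<Sum>z\<in>{z. brk (Hg i) (Dg m) z \<noteq> 0}. brk (Hg i) (Dg m) z * f z)
     = (of_int i - 1/2) * f (Hg (m + i))"
  "(\<Sum>z\<in>{z. brk (Hg i) (Hg j) z \<noteq> 0}. brk (Hg i) (Hg j) z * f z)
     = (if i + j = 1 then (of_int i - 1/2) * f C2 else 0)"
proof -
  have eq: "(\<Sum>z\<in>{z. brk x y z \<noteq> 0}. brk x y z * f z) = (\<Sum>z\<in>Z. brk x y z * f z)"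
    if "finite Z" "{z. brk x y z \<noteq> 0} \<subseteq> Z" for x y Z
    using that by (intro sum.mono_neutral_left) auto
  show "(\<Sum>z\<in>{z. brk (Dg m) (Dg n) z \<noteq> 0}. brk (Dg m) (Dg n) z * f z)
     = of_int (m - n) * f (Dg (m + n)) + (if m + n = 0 then of_int (m ^ 3 - m) / 12 * f C1 else 0)"
    by (subst eq[of "{Dg (m + n), C1}"]) (auto split: if_splits)
  show "(\<Sum>z\<in>{z. brk (Dg m) (Hg i) z \<noteq> 0}. brk (Dg m) (Hg i) z * f z)
     = - (of_int i - 1/2) * f (Hg (m + i))"
    by (subst eq[of "{Hg (m + i)}"]) (auto split: if_splits)
  show "(\<Sum>z\<in>{z. brk (Hg i) (Dg m) z \<noteq> 0}. brk (Hg i) (Dg m) z * f z)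
     = (of_int i - 1/2) * f (Hg (m + i))"
    by (subst eq[of "{Hg (m + i)}"]) (auto split: if_splits)
  show "(\<Sum>z\<in>{z. brk (Hg i) (Hg j) z \<noteq> 0}. brk (Hg i) (Hg j) z * f z)
     = (if i + j = 1 then (of_int i - 1/2) * f C2 else 0)"
    by (subst eq[of "{C2}"]) (auto split: if_splits)
qed

lemma brk_jacobi:
  "(\<Sum>z\<in>{z. brk x y z \<noteq> 0}. brk x y z * brk z t w)
    + (\<Sum>z\<in>{z. brk y t z \<noteq> 0}. brk y t z * brk z x w)
    + (\<Sum>z\<in>{z. brk t x z \<noteq> 0}. brk t x z * brk z y w) = 0" (is "?J x y t = 0")
proof -
  have DDD: "?J (Dg a) (Dg b) (Dg c) = 0" for a b c
  \<comment> \<open>The central term occurs only for total index 0, where the cocycle identity of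
    the cubic m^3 - m is checked.\<close>
  proof (cases "c = - a - b")
    case True
    show ?thesis
      unfolding sum_brk unfolding brk.simps True
      by (cases "a = - b") (auto simp: algebra_simps power3_eq_cube add_divide_distrib diff_divide_distrib)
  next
    case False
    then have "a + b + c \<noteq> 0" "b + c + a \<noteq> 0" "c + a + b \<noteq> 0"
      by auto
    then show ?thesis
      unfolding sum_brk unfolding brk.simps by (auto simp: algebra_simps)
  qed
  have DDH: "?J (Dg a) (Dg b) (Hg i) = 0" for a b i
    unfolding sum_brk unfolding brk.simps by (auto simp: algebra_simps add_divide_distrib diff_divide_distrib)
  have DHH: "?J (Dg a) (Hg i) (Hg j) = 0" for a i j
  proof (cases "j = 1 - a - i")
    case True
    show ?thesis
      unfolding sum_brk unfolding brk.simps True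
      by (auto simp: algebra_simps add_divide_distrib diff_divide_distrib)
  next
    case False
    then show ?thesis
      unfolding sum_brk unfolding brk.simps by (auto simp: algebra_simps)
  qed
  have HHH: "?J (Hg i) (Hg j) (Hg m) = 0" for i j m
    unfolding sum_brk unfolding brk.simps by auto
  \<comment> \<open>Rotating the triple permutes the summands, so each mixed triple reduces to one
    of the kinds above.\<close>
  have cycle: "?J x y t = ?J t x y" "?J x y t = ?J y t x" for x y t
    by simp_all
  have central: "brk x C1 z = 0" "brk C1 x z = 0" "brk x C2 z = 0" "brk C2 x z = 0" for x z
    by (cases x; simp)+
  show ?thesis
  proof (cases x; cases y; cases t)
  qed (simp_all only: DDD DDH DHH HHH cycle(1)[of "Dg _" "Hg _" "Dg _"] cycle(2)[of "Hg _" "Dg _" "Dg _"]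
      cycle(1)[of "Hg _" "Hg _" "Dg _"] cycle(2)[of "Hg _" "Dg _" "Hg _"], simp_all add: central)
qed

text \<open>The d's and \<open>C1\<close> take even values, the h's and \<open>C2\<close> odd ones.
  The raising elements fill the negative values, and the shift on the rest of the subalgebra leaves
  0 and 1 free for the central elements.\<close>

fun rank :: "int \<Rightarrow> gen \<Rightarrow> int" where
  "rank n (Dg m) = (if m < 0 then 2 * m else 2 * m + 2)"
| "rank n (Hg i) = (if i < 1 - n then 2 * (i + n) - 1 else 2 * (i + n) + 1)"
| "rank n C1 = 0"
| "rank n C2 = 1"

lemma inj_rank: "inj (rank n)"
proof (rule injI)
  fix x y assume "rank n x = rank n y"
  then show "x = y"
    by (cases x; cases y) (auto split: if_splits, presburger+)
qed

lemma rank_nonneg_iff: "0 \<le> rank n x \<longleftrightarrow> in_Dsub n x"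
  by (cases x) auto

lemma in_Dsub_brk: "in_Dsub n x \<Longrightarrow> in_Dsub n y \<Longrightarrow> brk x y z \<noteq> 0 \<Longrightarrow> in_Dsub n z"
  by (cases x; cases y) (auto split: if_splits)

lemma lie_subalgebra_module_of_Dsub_module:
  assumes "Dsub_module n sc rho"
  shows "based_lie_subalgebra_module sc brk (rank n) rho"
proof (intro based_lie_subalgebra_module.intro based_lie_subalgebra_module_axioms.intro)
  show "vector_space sc"
    using assms by (simp add: Dsub_module_def)
  show "inj (rank n)"
    by (rule inj_rank)
  show "finite {z. brk x y z \<noteq> 0}" for x y
    by (rule finite_brk)
  show "brk y x z = - brk x y z" for x y z
    by (rule brk_antisym)
  show "(\<Sum>z\<in>{z. brk x y z \<noteq> 0}. brk x y z * brk z t w)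
    + (\<Sum>z\<in>{z. brk y t z \<noteq> 0}. brk y t z * brk z x w)
    + (\<Sum>z\<in>{z. brk t x z \<noteq> 0}. brk t x z * brk z y w) = 0" for x y t w
    by (rule brk_jacobi)
  show "0 \<le> rank n z" if "0 \<le> rank n x" "0 \<le> rank n y" "brk x y z \<noteq> 0" for x y z
    using that in_Dsub_brk unfolding rank_nonneg_iff by blast
  show "Vector_Spaces.linear sc sc (rho x)" if "0 \<le> rank n x" for x
    using that assms unfolding rank_nonneg_iff Dsub_module_def by blast
  show "rho x (rho y v) - rho y (rho x v) = (\<Sum>z\<in>{z. brk x y z \<noteq> 0}. sc (brk x y z) (rho z v))"
    if "0 \<le> rank n x" "0 \<le> rank n y" for x y v
    using that assms unfolding rank_nonneg_iff Dsub_module_def brk_act_def by blast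
qed

section \<open>The free space and nonvanishing of the induced module\<close>

lemma vector_space_fscale: "vector_space fscale"
  by unfold_locales (auto simp: fscale_def fun_eq_iff algebra_simps)

interpretation fs: vector_space fscale
  by (rule vector_space_fscale)

lemma lmult_delta [simp]: "lmult x (delta w v) = delta (x # w) v"
  by (auto simp: lmult_def delta_def fun_eq_iff split: list.splits)

lemma linear_lmult: "Vector_Spaces.linear fscale fscale (lmult x)"
  by unfold_locales (auto simp: lmult_def fscale_def fun_eq_iff algebra_simps split: list.splits)

lemma finite_support_free_space: "f \<in> free_space \<Longrightarrow> finite {p. f p \<noteq> 0}"
proof -
  assume "f \<in> free_space"
  then have "f \<in> module.span fscale {delta w v | w v. True}"
    by (simp add: free_space_def)
  then show ?thesis
  proof (induction rule: fs.span_induct_alt)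
    case base
    show ?case by simp
  next
    case (step c x y)
    then obtain w v where x: "x = delta w v" by auto
    have "{p. (fscale c x + y) p \<noteq> 0} \<subseteq> insert (w, v) {p. y p \<noteq> 0}"
      by (auto simp: x fscale_def delta_def)
    then show ?case
      using step by (meson finite_insert finite_subset)
  qed
qed

lemma delta_in_free_space [simp]: "delta w v \<in> free_space"
  unfolding free_space_def by (rule fs.span_base) auto

lemma subspace_free_space: "module.subspace fscale free_space"
  unfolding free_space_def by (rule fs.subspace_span)

lemmas free_space_closed =
  fs.subspace_0[OF subspace_free_space] fs.subspace_add[OF subspace_free_space]
  fs.subspace_diff[OF subspace_free_space] fs.subspace_scale[OF subspace_free_space]
  fs.subspace_sum[OF subspace_free_space]

lemma ind_relations_subset_free_space: "ind_relations n sc rho \<subseteq> free_space"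
  unfolding ind_relations_def
  by (auto intro!: free_space_closed)

lemma ind_kernel_subset_free_space: "ind_kernel n sc rho \<subseteq> free_space"
  unfolding ind_kernel_def
  by (rule fs.span_minimal[OF ind_relations_subset_free_space subspace_free_space])

text \<open>\<open>psi\<close> extends linearly to a map that kills all three kinds of relations, by
  \<open>psi_linear\<close>, \<open>psi_exchange\<close> and \<open>psi_snoc\<close>, but sends
  \<open>delta [] v\<close> to \<open>v\<close>.\<close>

lemma ind_kernel_neq_free_space:
  fixes rho :: "gen \<Rightarrow> 'v::ab_group_add \<Rightarrow> 'v"
  assumes V: "Dsub_module n sc rho" and nz: "(UNIV :: 'v set) \<noteq> {0}"
  shows "ind_kernel n sc rho \<noteq> free_space"
proof
  assume eq: "ind_kernel n sc rho = free_space"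
  interpret based_lie_subalgebra_module sc brk "rank n" rho
    using V by (rule lie_subalgebra_module_of_Dsub_module)
  \<comment> \<open>Supports are finite on \<open>free_space\<close>, so the linearity of
    \<open>ext\<close> is claimed there only.\<close>
  define ext where "ext f = (\<Sum>p\<in>{p. f p \<noteq> 0}. sc (f p) (psi (fst p) (snd p)))"
    for f :: "gen list \<times> 'v \<Rightarrow> complex"
  have ext_eq: "ext f = (\<Sum>p\<in>Z. sc (f p) (psi (fst p) (snd p)))"
    if "finite Z" "{p. f p \<noteq> 0} \<subseteq> Z" for f Z
    unfolding ext_def using that by (intro sum.mono_neutral_left) auto
  have ext_add: "ext (f + g) = ext f + ext g" if "f \<in> free_space" "g \<in> free_space" for f g
  proof -
    let ?Z = "{p. f p \<noteq> 0} \<union> {p. g p \<noteq> 0}"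
    have "finite ?Z"
      using that by (simp add: finite_support_free_space)
    then show ?thesis
      by (subst (1 2 3) ext_eq[of ?Z]) (auto simp: scale_left_distrib sum.distrib)
  qed
  have ext_scale: "ext (fscale a f) = sc a (ext f)" if "f \<in> free_space" for a f
    using finite_support_free_space[OF that]
    by (subst (1 2) ext_eq[of "{p. f p \<noteq> 0}"]) (auto simp: fscale_def scale_sum_right)
  have ext_zero: "ext 0 = 0"
    by (simp add: ext_def)
  have ext_diff: "ext (f - g) = ext f - ext g" if "f \<in> free_space" "g \<in> free_space" for f g
  proof -
    have "f - g = f + fscale (- 1) g"
      by (auto simp: fscale_def fun_eq_iff)
    then have "ext (f - g) = ext f + sc (- 1) (ext g)"
      using that by (simp only: ext_add ext_scale free_space_closed)
    then show ?thesis by simp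
  qed
  have ext_sum: "ext (\<Sum>z\<in>Z. h z) = (\<Sum>z\<in>Z. ext (h z))"
    if "\<And>z. h z \<in> free_space" for h and Z :: "gen set"
    by (induction Z rule: infinite_finite_induct)
      (simp_all only: sum.infinite sum.empty sum.insert not_False_eq_True
        ext_zero ext_add that free_space_closed)
  have ext_delta: "ext (delta w v) = psi w v" for w v
    by (subst ext_eq[of "{(w, v)}"]) (auto simp: delta_def)
  have rel: "ext f = 0" if "f \<in> ind_relations n sc rho" for f
    using that unfolding ind_relations_def
  proof (elim UnE CollectE exE conjE)
    fix w a b v v'
    assume "f = delta w (sc a v + sc b v') - fscale a (delta w v) - fscale b (delta w v')"
    then show ?thesis
      by (simp add: ext_diff ext_scale ext_delta psi_linear free_space_closed)
  next
    fix u x y t v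
    assume "f = delta (u @ [x, y] @ t) v - delta (u @ [y, x] @ t) v
        - (\<Sum>z\<in>{z. brk x y z \<noteq> 0}. fscale (brk x y z) (delta (u @ [z] @ t) v))"
    then show ?thesis
      using psi_exchange[of u x y t v]
      by (simp add: ext_diff ext_scale ext_delta ext_sum free_space_closed bsum_def)
  next
    fix w p v
    assume "f = delta (w @ [p]) v - delta w (rho p v)" "in_Dsub n p"
    then show ?thesis
      by (simp add: ext_diff ext_delta psi_snoc rank_nonneg_iff)
  qed
  have ker: "f \<in> free_space \<and> ext f = 0" if "f \<in> ind_kernel n sc rho" for f
    using that unfolding ind_kernel_def
  proof (induction rule: fs.span_induct_alt)
    case base
    then show ?case
      using ext_zero free_space_closed(1) by blast
  next
    case (step c x y)
    have "x \<in> free_space"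
      using step(1) ind_relations_subset_free_space by blast
    then show ?case
      using step rel[of x] by (simp only: ext_add ext_scale free_space_closed scale_zero_right add_0_left simp_thms)
  qed
  have "psi [] v = 0" for v
    using ext_delta[of "[]" v] ker[of "delta [] v"] eq by auto
  then show False
    using nz by auto
qed

section \<open>The weight filtration\<close>

text \<open>The degree bounds how far an element raises the filtration. Degree 0 goes to the
  elements of the subalgebra that the vanishing hypotheses on V do not cover; negative degrees are
  opposites of odd weights, so that a lowering element can cancel exactly one raising
  letter.\<close>

fun deg :: "int \<Rightarrow> int \<Rightarrow> int \<Rightarrow> gen \<Rightarrow> int" where
  "deg k n l (Dg m) = (if m < 0 then 1 - 2 * m else if m \<le> l then 0 else 2 * (l - m) - 1)"
| "deg k n l (Hg i) = (if i < 1 - n then 2 * (1 - n - i) + 1 else if i \<le> k then 0 else 2 * (k - i) - 1)"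
| "deg k n l C1 = 0"
| "deg k n l C2 = 0"

lemma deg_pos_iff: "0 < deg k n l x \<longleftrightarrow> \<not> in_Dsub n x"
  by (cases x) auto

text \<open>Two brackets are critical. That of \<open>d_{l+a}\<close> and \<open>X_b\<close> is a
  multiple of H with index l + 1 - n + a - b, at least k + a - b because
  \<open>n + k - 1 \<le> l\<close>. That of \<open>H_{k+a}\<close> and \<open>Y_b\<close> is a
  multiple of \<open>H_{k+a-b}\<close>; when this is raising, its weight is low enough because
  \<open>2 \<le> k + n\<close>.\<close>

lemma deg_brk_le:
  assumes "n \<le> k" "2 \<le> k + n" "n + k - 1 \<le> l" "0 < deg k n l r" "brk g r z \<noteq> 0"
  shows "deg k n l z \<le> deg k n l g + deg k n l r"
  using assms by (cases g; cases r) (auto split: if_splits)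

lemma deg_brk_less:
  assumes "n \<le> k" "2 \<le> k + n" "n + k - 1 \<le> l" "0 < deg k n l g" "0 < deg k n l r" "brk g r z \<noteq> 0"
  shows "deg k n l z < deg k n l g + deg k n l r"
  using assms by (cases g; cases r) (auto split: if_splits)

text \<open>\<open>A\<close> and \<open>e\<close> model the action of the whole algebra on the
  induced module and the map v to 1 \<otimes> v. An abstract module keeps congruences modulo the
  relations out of the filtration argument.\<close>

locale filtered_action = V: vector_space sc + M: vector_space scm
  for sc :: "complex \<Rightarrow> 'v::ab_group_add \<Rightarrow> 'v"
    and scm :: "complex \<Rightarrow> 'm::ab_group_add \<Rightarrow> 'm" +
  fixes k n l :: int
    and rho :: "gen \<Rightarrow> 'v \<Rightarrow> 'v"
    and A :: "gen \<Rightarrow> 'm \<Rightarrow> 'm"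
    and e :: "'v \<Rightarrow> 'm"
  assumes n_le_k: "n \<le> k" and kn_ge: "2 \<le> k + n" and l_ge: "n + k - 1 \<le> l"
    and A_linear: "Vector_Spaces.linear scm scm (A x)"
    and A_comm: "A x (A y m) - A y (A x m) = brk_act scm A x y m"
    and e_linear: "Vector_Spaces.linear sc scm e"
    and A_e: "in_Dsub n p \<Longrightarrow> A p (e v) = e (rho p v)"
    and rho_linear: "in_Dsub n p \<Longrightarrow> Vector_Spaces.linear sc sc (rho p)"
    and rho_H: "i > k \<Longrightarrow> rho (Hg i) v = 0"
    and rho_D: "j > l \<Longrightarrow> rho (Dg j) v = 0"
begin

interpretation A: Vector_Spaces.linear scm scm "A x" for x
  by (rule A_linear)

interpretation e: Vector_Spaces.linear sc scm e
  by (rule e_linear)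

section \<open>The weight filtration by words of raising elements\<close>

abbreviation dg :: "gen \<Rightarrow> int" where
  "dg \<equiv> deg k n l"

abbreviation raising :: "gen set \<Rightarrow> bool" where
  "raising X \<equiv> \<forall>x\<in>X. 0 < dg x"

definition act :: "gen list \<Rightarrow> 'm \<Rightarrow> 'm" where
  "act xs u = foldr A xs u"

lemma act_Nil [simp]: "act [] u = u"
  by (simp add: act_def)

lemma act_Cons [simp]: "act (x # xs) u = A x (act xs u)"
  by (simp add: act_def)

lemma act_add: "act xs (u + w) = act xs u + act xs w"
  by (induction xs) (auto simp: A.add)

lemma act_scale: "act xs (scm a u) = scm a (act xs u)"
  by (induction xs) (auto simp: A.scale)

definition wt :: "gen multiset \<Rightarrow> int" where
  "wt \<mu> = (\<Sum>x\<in>#\<mu>. dg x)"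

lemma wt_simps [simp]: "wt {#} = 0" "wt (add_mset x \<mu>) = dg x + wt \<mu>"
  by (auto simp: wt_def)

lemma wt_nonneg: "raising (set_mset \<mu>) \<Longrightarrow> 0 \<le> wt \<mu>"
  by (induction \<mu>) auto

lemma wt_remove: "r \<in># \<mu> \<Longrightarrow> wt (\<mu> - {#r#}) = wt \<mu> - dg r"
  by (metis insert_DiffM wt_simps(2) add_diff_cancel_left')

definition F :: "int \<Rightarrow> 'm set" where
  "F N = M.span {act xs (e v) | xs v. raising (set xs) \<and> wt (mset xs) \<le> N}"

lemma act_in_F: "raising (set xs) \<Longrightarrow> wt (mset xs) \<le> N \<Longrightarrow> act xs (e v) \<in> F N"
  unfolding F_def by (rule M.span_base) auto

lemma F_mono: "N \<le> N' \<Longrightarrow> F N \<subseteq> F N'"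
  unfolding F_def by (rule M.span_mono) auto

lemma F_closed:
  "0 \<in> F N" "u \<in> F N \<Longrightarrow> w \<in> F N \<Longrightarrow> u + w \<in> F N" "u \<in> F N \<Longrightarrow> w \<in> F N \<Longrightarrow> u - w \<in> F N"
  "u \<in> F N \<Longrightarrow> scm a u \<in> F N"
  unfolding F_def by (auto intro: M.span_zero M.span_add M.span_diff M.span_scale)

lemma F_sum: "(\<And>i. i \<in> I \<Longrightarrow> h i \<in> F N) \<Longrightarrow> (\<Sum>i\<in>I. h i) \<in> F N"
  unfolding F_def by (rule M.span_sum)

lemma F_trans: "u - w \<in> F N \<Longrightarrow> w - w' \<in> F N \<Longrightarrow> u - w' \<in> F N"
  using F_closed(2)[of "u - w" N "w - w'"] by simp

text \<open>Raising words have nonnegative weight. This anchors the induction on the degree: an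
  element of degree 0 equals its leading term.\<close>

lemma F_neg:
  assumes "N < 0" shows "F N = {0}"
proof -
  have "{act xs (e v) | xs v. raising (set xs) \<and> wt (mset xs) \<le> N} = {}"
  proof -
    have "\<not> wt (mset xs) \<le> N" if "raising (set xs)" for xs
      using wt_nonneg[of "mset xs"] that assms by auto
    then show ?thesis by blast
  qed
  then show ?thesis
    unfolding F_def by (metis M.span_empty)
qed

lemma brk_act_in_F:
  "(\<And>z. brk x y z \<noteq> 0 \<Longrightarrow> A z u \<in> F N) \<Longrightarrow> brk_act scm A x y u \<in> F N"
  unfolding brk_act_def by (rule F_sum) (auto intro: F_closed)

lemma A_A: "A x (A y u) = A y (A x u) + brk_act scm A x y u"
  using A_comm[of x y u] by (simp add: algebra_simps)

lemma A_in_F_of_words: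
  assumes "\<And>xs v. raising (set xs) \<Longrightarrow> wt (mset xs) \<le> N \<Longrightarrow> A g (act xs (e v)) \<in> F N'"
    and "u \<in> F N"
  shows "A g u \<in> F N'"
  using assms(2) unfolding F_def[of N]
  by (induction rule: M.span_induct_alt) (auto simp: A.add A.scale intro!: F_closed assms(1))

text \<open>A raising \<open>g\<close> only adds a letter. Any other \<open>g\<close> is commuted
  past the letters one by one, with \<open>deg_brk_le\<close> bounding the brackets, until it meets
  V, where an element of negative degree acts by 0.\<close>

lemma A_act_in_F: "raising (set xs) \<Longrightarrow> A g (act xs (e v)) \<in> F (wt (mset xs) + dg g)"
proof (cases "0 < dg g")
  case True
  assume "raising (set xs)"
  then show ?thesis
    using act_in_F[of "g # xs" _ v] True by auto
next
  case False
  assume "raising (set xs)"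
  then show ?thesis
    using False
  proof (induction xs arbitrary: g)
    case Nil
    then have g: "in_Dsub n g"
      using deg_pos_iff by blast
    show ?case
    proof (cases "dg g = 0")
      case True
      then show ?thesis
        using act_in_F[of "[]" 0] g by (simp add: A_e)
    next
      case False
      then have "rho g v = 0"
        using Nil.prems rho_H rho_D by (cases g) (auto split: if_splits)
      then show ?thesis
        using g by (simp add: A_e e.zero F_closed)
    qed
  next
    case (Cons r xs)
    \<comment> \<open>The bracket of \<open>g\<close> with \<open>r\<close> may be raising or not,
      so the bound on the shorter word is needed for all generators.\<close>
    have any: "A z (act xs (e v)) \<in> F (wt (mset xs) + dg z)" for z
    proof (cases "0 < dg z")
      case True
      then show ?thesis
        using act_in_F[of "z # xs" _ v] Cons.prems by auto
    next
      case False
      then show ?thesis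
        using Cons by auto
    qed
    have "A r (A g (act xs (e v))) \<in> F (wt (mset xs) + dg g + dg r)"
    proof (rule A_in_F_of_words[OF _ any])
      fix ys v assume "raising (set ys)" "wt (mset ys) \<le> wt (mset xs) + dg g"
      then show "A r (act ys (e v)) \<in> F (wt (mset xs) + dg g + dg r)"
        using act_in_F[of "r # ys" _ v] Cons.prems by auto
    qed
    moreover have "brk_act scm A g r (act xs (e v)) \<in> F (wt (mset xs) + dg g + dg r)"
    proof (rule brk_act_in_F)
      fix z assume "brk g r z \<noteq> 0"
      then have "dg z \<le> dg g + dg r"
        using deg_brk_le n_le_k kn_ge l_ge Cons.prems by auto
      then show "A z (act xs (e v)) \<in> F (wt (mset xs) + dg g + dg r)"
        using any[of z] F_mono[of "wt (mset xs) + dg z" "wt (mset xs) + dg g + dg r"] by auto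
    qed
    ultimately have "A r (A g (act xs (e v))) + brk_act scm A g r (act xs (e v))
        \<in> F (wt (mset xs) + dg g + dg r)"
      by (rule F_closed)
    moreover have "wt (mset (r # xs)) + dg g = wt (mset xs) + dg g + dg r"
      by simp
    ultimately show ?case
      by (simp only: A_A[of g r] act_Cons)
  qed
qed

lemma A_in_F:
  assumes "u \<in> F N" "N + dg g \<le> N'" shows "A g u \<in> F N'"
proof (rule A_in_F_of_words[OF _ assms(1)])
  fix xs v assume "raising (set xs)" "wt (mset xs) \<le> N"
  then show "A g (act xs (e v)) \<in> F N'"
    using A_act_in_F[of xs g v] F_mono[of "wt (mset xs) + dg g" N'] assms(2) by auto
qed

section \<open>Commutativity of leading terms\<close>

lemma brk_act_raising_in_F:
  assumes "u \<in> F N" "\<And>z. brk x y z \<noteq> 0 \<Longrightarrow> N + dg z \<le> N'"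
  shows "brk_act scm A x y u \<in> F N'"
  using assms by (intro brk_act_in_F A_in_F[of u N])

text \<open>Each exchange of \<open>r\<close> with a raising letter costs a bracket of strictly
  smaller degree by \<open>deg_brk_less\<close>; degrees are integers, hence the bound with -
  1.\<close>

lemma act_remove1:
  assumes "raising (set xs)" "r \<in> set xs"
  shows "act xs (e v) - act (r # remove1 r xs) (e v) \<in> F (wt (mset xs) - 1)"
  using assms
proof (induction xs)
  case Nil
  then show ?case by simp
next
  case (Cons x xs)
  show ?case
  proof (cases "x = r")
    case True
    then show ?thesis by (simp add: F_closed)
  next
    case False
    let ?w = "act (remove1 r xs) (e v)"
    have r: "r \<in> set xs" "0 < dg r" "0 < dg x" "raising (set xs)"
      using False Cons.prems by auto
    have rem: "wt (mset (remove1 r xs)) = wt (mset xs) - dg r"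
      using r by (simp add: wt_remove)
    have "raising (set (remove1 r xs))"
      using r(4) by (meson in_mono set_remove1_subset)
    then have w: "?w \<in> F (wt (mset xs) - dg r)"
      by (intro act_in_F) (simp_all only: rem)
    have "A x (act xs (e v) - A r ?w) \<in> F (wt (mset (x # xs)) - 1)"
      by (rule A_in_F) (use Cons.IH r in auto)
    moreover have "brk_act scm A x r ?w \<in> F (wt (mset (x # xs)) - 1)"
      by (rule brk_act_raising_in_F[OF w])
        (use deg_brk_less[OF n_le_k kn_ge l_ge r(3,2)] in fastforce)
    ultimately have "A x (act xs (e v)) - A x (A r ?w) + brk_act scm A x r ?w \<in> F (wt (mset (x # xs)) - 1)"
      using F_closed(2) by (simp only: A.diff)
    then show ?thesis
      using False by (simp add: A_A[of x r])
  qed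
qed

text \<open>The first letter of \<open>xs\<close> is brought to the front of \<open>ys\<close>, and
  the remaining letters are compared by induction.\<close>

lemma act_perm:
  assumes "raising (set xs)" "mset xs = mset ys"
  shows "act xs (e v) - act ys (e v) \<in> F (wt (mset xs) - 1)"
  using assms
proof (induction xs arbitrary: ys)
  case Nil
  then show ?case by (simp add: F_closed)
next
  case (Cons x xs)
  have set_ys: "set ys = set (x # xs)"
    using Cons.prems(2) by (metis mset_eq_setD)
  then have x: "x \<in> set ys"
    by simp
  have rem: "mset xs = mset (remove1 x ys)"
    by (simp flip: Cons.prems(2))
  have 1: "A x (act xs (e v) - act (remove1 x ys) (e v)) \<in> F (wt (mset (x # xs)) - 1)"
    by (rule A_in_F[OF Cons.IH[OF _ rem]]) (use Cons.prems(1) in auto)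
  have "raising (set ys)"
    using set_ys Cons.prems(1) by simp
  from act_remove1[OF this x, of v]
  have "act ys (e v) - act (x # remove1 x ys) (e v) \<in> F (wt (mset (x # xs)) - 1)"
    by (simp only: Cons.prems(2))
  from F_closed(3)[OF 1 this] show ?case
    by (simp add: A.diff)
qed

text \<open>Any ordering of the letters may represent the monomial: for raising letters the choice
  matters only below the leading degree, by \<open>act_perm\<close>.\<close>

definition mon :: "gen multiset \<Rightarrow> 'v \<Rightarrow> 'm" where
  "mon \<mu> v = act (SOME xs. mset xs = \<mu>) (e v)"

lemma mon_add: "mon \<mu> (v + v') = mon \<mu> v + mon \<mu> v'"
  by (simp add: mon_def e.add act_add)

lemma mon_scale: "mon \<mu> (sc a v) = scm a (mon \<mu> v)"
  by (simp add: mon_def e.scale act_scale)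

lemma mon_zero [simp]: "mon \<mu> 0 = 0"
  using mon_scale[of \<mu> 0 0] by simp

lemma mon_empty [simp]: "mon {#} v = e v"
  by (simp add: mon_def)

lemma mset_SOME: "mset (SOME xs. mset xs = \<mu>) = \<mu>"
  by (metis (mono_tags) ex_mset someI_ex)

lemma act_mon:
  "raising (set xs) \<Longrightarrow> act xs (e v) - mon (mset xs) v \<in> F (wt (mset xs) - 1)"
  unfolding mon_def by (rule act_perm) (simp_all add: mset_SOME)

text \<open>Such an \<open>f\<close> passes every raising letter modulo lower terms, so on leading
  terms it acts only on the coefficients in V.\<close>

definition slides :: "gen \<Rightarrow> bool" where
  "slides f \<longleftrightarrow> in_Dsub n f \<and> (\<forall>r z. 0 < dg r \<longrightarrow> brk f r z \<noteq> 0 \<longrightarrow> dg z < dg r)"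

lemma slides_act:
  assumes f: "slides f" and "raising (set xs)"
  shows "A f (act xs (e v)) - act xs (e (rho f v)) \<in> F (wt (mset xs) - 1)"
  using assms(2)
proof (induction xs)
  case Nil
  then show ?case
    using f by (simp add: slides_def A_e F_closed)
next
  case (Cons r xs)
  have "A r (A f (act xs (e v)) - act xs (e (rho f v))) \<in> F (wt (mset (r # xs)) - 1)"
    by (rule A_in_F[OF Cons.IH]) (use Cons.prems in auto)
  moreover have "brk_act scm A f r (act xs (e v)) \<in> F (wt (mset (r # xs)) - 1)"
    by (rule brk_act_raising_in_F[OF act_in_F[of xs "wt (mset xs)"]])
      (use Cons.prems f in \<open>auto simp: slides_def\<close>)
  ultimately have "A r (A f (act xs (e v))) - A r (act xs (e (rho f v))) + brk_act scm A f r (act xs (e v))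
      \<in> F (wt (mset (r # xs)) - 1)"
    using F_closed(2) by (simp only: A.diff)
  then show ?case
    by (simp add: A_A[of f r] algebra_simps)
qed

text \<open>On leading terms in the variables \<open>U\<close>, a detector \<open>g\<close> acts as \<open>c f \<partial>/\<partial>r\<close>.\<close>

definition detector :: "gen set \<Rightarrow> gen \<Rightarrow> gen \<Rightarrow> gen \<Rightarrow> complex \<Rightarrow> bool" where
  "detector U r g f c \<longleftrightarrow> c \<noteq> 0 \<and> 0 < dg r \<and> in_Dsub n g \<and> dg g = - dg r
     \<and> slides f \<and> inj (rho f) \<and> (\<forall>u. brk_act scm A g r u = scm c (A f u))
     \<and> (\<forall>s\<in>U. \<forall>z. s \<noteq> r \<longrightarrow> brk g s z \<noteq> 0 \<longrightarrow> dg z < dg g + dg s)"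

text \<open>\<open>g\<close> passes through the word like a derivation. A letter \<open>r\<close>
  turns into \<open>c\<close> times \<open>f\<close>, which slides on to V; any other letter of
  \<open>U\<close> gives a bracket of too low degree; and on V itself \<open>g\<close> acts by 0
  because its degree is negative.\<close>

lemma detector_act:
  assumes d: "detector U r g f c" and "raising (set xs)" "set xs \<subseteq> U"
  shows "A g (act xs (e v)) - scm (c * of_nat (count (mset xs) r)) (act (remove1 r xs) (e (rho f v)))
    \<in> F (wt (mset xs) - dg r - 1)"
  using assms(2,3)
proof (induction xs)
  case Nil
  have "rho g v = 0"
    using d rho_H rho_D by (cases g) (auto simp: detector_def split: if_splits)
  then show ?case
    using d by (simp add: detector_def A_e e.zero F_closed)
next
  case (Cons s xs)
  let ?N = "wt (mset (s # xs)) - dg r - 1"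
  let ?w = "act xs (e v)" and ?w' = "act (remove1 r xs) (e (rho f v))"
  let ?a = "c * of_nat (count (mset xs) r)"
  have s: "0 < dg s" and xs: "raising (set xs)" "set xs \<subseteq> U"
    using Cons.prems by auto
  have dr: "0 < dg r" "dg g = - dg r"
    using d by (auto simp: detector_def)
  have 1: "A s (A g ?w) - scm ?a (A s ?w') \<in> F ?N"
    using A_in_F[OF Cons.IH[OF xs], of s ?N] by (simp add: A.diff A.scale)
  show ?case
  proof (cases "s = r")
    case False
    have "brk_act scm A g s ?w \<in> F ?N"
      by (rule brk_act_raising_in_F[OF act_in_F[of xs "wt (mset xs)"]])
        (use xs d Cons.prems False dr in \<open>fastforce simp: detector_def\<close>)+
    then have "(A s (A g ?w) - scm ?a (A s ?w')) + brk_act scm A g s ?w \<in> F ?N"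
      using 1 F_closed(2) by blast
    then show ?thesis
      using False by (simp add: A_A[of g s] algebra_simps)
  next
    case True
    let ?x = "act xs (e (rho f v))"
    have N: "?N = wt (mset xs) - 1"
      using True by simp
    \<comment> \<open>Putting the front letter \<open>r\<close> back in place of the removed one
      gives the occurrences inside \<open>xs\<close> the same word as the new one. If
      \<open>xs\<close> has no \<open>r\<close>, nothing was removed, but the coefficient is
      0.\<close>
    have "scm ?a (A r ?w') - scm ?a ?x \<in> F ?N"
    proof (cases "r \<in> set xs")
      case r: True
      have "?x - A r ?w' \<in> F ?N"
        using act_remove1[OF xs(1) r, of "rho f v"] unfolding N by simp
      then have "scm (- ?a) (?x - A r ?w') \<in> F ?N"
        by (rule F_closed)
      then show ?thesis
        by (simp add: M.scale_right_diff_distrib)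
    next
      case False
      then have "count (mset xs) r = 0"
        by simp
      then show ?thesis
        by (simp only: of_nat_0 mult_zero_right M.scale_zero_left diff_self F_closed)
    qed
    from F_trans[OF 1[unfolded True] this[unfolded True]]
    have 2: "A r (A g ?w) - scm ?a ?x \<in> F ?N"
      using True by simp
    have "scm c (A f ?w - ?x) \<in> F ?N"
      using slides_act[OF _ xs(1), of f v] d by (simp only: N F_closed detector_def)
    with 2 have "(A r (A g ?w) - scm ?a ?x) + scm c (A f ?w - ?x) \<in> F ?N"
      by (rule F_closed)
    moreover have "A g (A r ?w) = A r (A g ?w) + scm c (A f ?w)"
      using d A_A[of g r ?w] by (simp add: detector_def)
    moreover have "scm (c * of_nat (count (mset (r # xs)) r)) ?x = scm ?a ?x + scm c ?x"
      by (simp add: algebra_simps)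
    ultimately show ?thesis
      using True by (simp add: algebra_simps)
  qed
qed

lemma detector_mon:
  assumes d: "detector U r g f c" and "raising (set_mset \<mu>)" "set_mset \<mu> \<subseteq> U"
  shows "A g (mon \<mu> v) - scm (c * of_nat (count \<mu> r)) (mon (\<mu> - {#r#}) (rho f v))
    \<in> F (wt \<mu> - dg r - 1)"
proof -
  obtain xs where xs: "mset xs = \<mu>" "mon \<mu> v = act xs (e v)"
    using mset_SOME[of \<mu>] unfolding mon_def by blast
  have set_xs: "set xs = set_mset \<mu>"
    by (metis set_mset_mset xs(1))
  let ?a = "c * of_nat (count \<mu> r)"
  have 1: "A g (mon \<mu> v) - scm ?a (act (remove1 r xs) (e (rho f v))) \<in> F (wt \<mu> - dg r - 1)"
    using detector_act[OF d, of xs v] assms(2,3) set_xs by (simp add: xs)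
  have "scm ?a (act (remove1 r xs) (e (rho f v))) - scm ?a (mon (\<mu> - {#r#}) (rho f v))
      \<in> F (wt \<mu> - dg r - 1)"
  proof (cases "r \<in># \<mu>")
    case True
    have "raising (set (remove1 r xs))"
      using assms(2) set_xs by (metis in_mono set_remove1_subset)
    from act_mon[OF this, of "rho f v"]
    have "scm ?a (act (remove1 r xs) (e (rho f v)) - mon (\<mu> - {#r#}) (rho f v)) \<in> F (wt \<mu> - dg r - 1)"
      using True xs(1) by (simp add: wt_remove F_closed)
    then show ?thesis
      by (simp add: M.scale_right_diff_distrib)
  next
    case False
    then show ?thesis
      by (simp add: F_closed not_in_iff)
  qed
  with 1 show ?thesis
    by (rule F_trans)
qed

text \<open>The finite family \<open>p\<close> is a formal symbol of \<open>u\<close>: only the sum of its monomials is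
  determined by \<open>u\<close>, since linear independence of the monomials is not presupposed.\<close>

definition symbol :: "'m \<Rightarrow> int \<Rightarrow> gen multiset set \<Rightarrow> (gen multiset \<Rightarrow> 'v) \<Rightarrow> bool" where
  "symbol u N T p \<longleftrightarrow> finite T \<and> (\<forall>\<mu>\<in>T. raising (set_mset \<mu>) \<and> wt \<mu> = N)
     \<and> u - (\<Sum>\<mu>\<in>T. mon \<mu> (p \<mu>)) \<in> F (N - 1)"

text \<open>Removing \<open>r\<close> is injective on the multisets containing it, so leading terms
  never merge: each new coefficient comes from a single old one. The factor
  \<open>Suc (count \<nu> r)\<close> is the exponent brought down by differentiation.\<close>

lemma detector_symbol:
  assumes d: "detector U r g f c" and U: "\<And>\<mu>. \<mu> \<in> T \<Longrightarrow> set_mset \<mu> \<subseteq> U"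
    and sym: "symbol u N T p"
  shows "symbol (A g u) (N - dg r) ((\<lambda>\<mu>. \<mu> - {#r#}) ` {\<mu>\<in>T. r \<in># \<mu>})
    (\<lambda>\<nu>. sc (c * of_nat (Suc (count \<nu> r))) (rho f (p (add_mset r \<nu>))))"
  (is "symbol _ _ ?T' ?p'")
proof -
  let ?h = "\<lambda>\<mu>. scm (c * of_nat (count \<mu> r)) (mon (\<mu> - {#r#}) (rho f (p \<mu>)))"
  have fin: "finite T" and T: "\<And>\<mu>. \<mu> \<in> T \<Longrightarrow> raising (set_mset \<mu>) \<and> wt \<mu> = N"
    and u: "u - (\<Sum>\<mu>\<in>T. mon \<mu> (p \<mu>)) \<in> F (N - 1)"
    using sym by (auto simp: symbol_def)
  have inj: "inj_on (\<lambda>\<mu>. \<mu> - {#r#}) {\<mu>\<in>T. r \<in># \<mu>}"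
    by (rule inj_onI) (metis (mono_tags, lifting) insert_DiffM mem_Collect_eq)
  have "(\<Sum>\<nu>\<in>?T'. mon \<nu> (?p' \<nu>)) = (\<Sum>\<mu>\<in>{\<mu>\<in>T. r \<in># \<mu>}. ?h \<mu>)"
    unfolding sum.reindex[OF inj] o_def
  proof (rule sum.cong[OF refl])
    fix \<mu> assume "\<mu> \<in> {\<mu>\<in>T. r \<in># \<mu>}"
    then have "add_mset r (\<mu> - {#r#}) = \<mu>" "Suc (count (\<mu> - {#r#}) r) = count \<mu> r"
      by (auto simp: Suc_diff_le)
    then show "mon (\<mu> - {#r#}) (?p' (\<mu> - {#r#})) = ?h \<mu>"
      by (simp only: mon_scale)
  qed
  also have "\<dots> = (\<Sum>\<mu>\<in>T. ?h \<mu>)"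
    using fin by (intro sum.mono_neutral_left) (auto simp: not_in_iff)
  finally have eq: "(\<Sum>\<nu>\<in>?T'. mon \<nu> (?p' \<nu>)) = (\<Sum>\<mu>\<in>T. ?h \<mu>)" .
  have "A g (u - (\<Sum>\<mu>\<in>T. mon \<mu> (p \<mu>))) \<in> F (N - dg r - 1)"
    by (rule A_in_F[OF u]) (use d in \<open>auto simp: detector_def\<close>)
  moreover have "(\<Sum>\<mu>\<in>T. A g (mon \<mu> (p \<mu>)) - ?h \<mu>) \<in> F (N - dg r - 1)"
  proof (rule F_sum)
    fix \<mu> assume "\<mu> \<in> T"
    then show "A g (mon \<mu> (p \<mu>)) - ?h \<mu> \<in> F (N - dg r - 1)"
      using detector_mon[OF d, of \<mu> "p \<mu>"] T[of \<mu>] U[of \<mu>] by simp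
  qed
  ultimately have "A g (u - (\<Sum>\<mu>\<in>T. mon \<mu> (p \<mu>))) + (\<Sum>\<mu>\<in>T. A g (mon \<mu> (p \<mu>)) - ?h \<mu>) \<in> F (N - dg r - 1)"
    by (rule F_closed)
  then have "A g u - (\<Sum>\<nu>\<in>?T'. mon \<nu> (?p' \<nu>)) \<in> F (N - dg r - 1)"
    unfolding eq by (simp add: A.diff A.sum sum_subtractf)
  moreover have "raising (set_mset \<nu>) \<and> wt \<nu> = N - dg r" if "\<nu> \<in> ?T'" for \<nu>
    using that T by (auto simp: wt_remove dest: in_diffD)
  ultimately show ?thesis
    using fin by (simp add: symbol_def)
qed

text \<open>A detector for a variable that occurs in the symbol lowers the degree and leaves a
  nonempty symbol. Its coefficients stay nonzero because \<open>rho f\<close> is injective and the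
  exponents are nonzero in characteristic 0. This is repeated until no variable is left.\<close>

lemma symbol_meets_image:
  assumes detect: "\<And>U. U \<noteq> {} \<Longrightarrow> raising U \<Longrightarrow> \<exists>r\<in>U. \<exists>g f c. detector U r g f c"
    and S: "\<And>x u. u \<in> S \<Longrightarrow> A x u \<in> S"
    and "u \<in> S" "symbol u (int N) T p" "T \<noteq> {}" "\<And>\<mu>. \<mu> \<in> T \<Longrightarrow> p \<mu> \<noteq> 0"
  shows "\<exists>v. v \<noteq> 0 \<and> e v \<in> S"
  using assms(3-)
proof (induction N arbitrary: u T p rule: less_induct)
  case (less N)
  define U where "U = (\<Union>\<mu>\<in>T. set_mset \<mu>)"
  have T: "\<And>\<mu>. \<mu> \<in> T \<Longrightarrow> raising (set_mset \<mu>) \<and> wt \<mu> = int N"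
    and u: "u - (\<Sum>\<mu>\<in>T. mon \<mu> (p \<mu>)) \<in> F (int N - 1)"
    using less.prems(2) by (auto simp: symbol_def)
  show ?case
  proof (cases "U = {}")
    case True
    \<comment> \<open>Without variables only the empty monomial remains, so the degree is 0 and the
      error lies in \<open>F (- 1)\<close>, which is zero.\<close>
    then have eq: "T = {{#}}"
      using less.prems(3) by (auto simp: U_def)
    then have "N = 0"
      using T by auto
    then have "u = e (p {#})"
      using u F_neg[of "- 1"] eq by simp
    then show ?thesis
      using less.prems eq by blast
  next
    case False
    have "raising U"
      using T by (auto simp: U_def)
    from detect[OF False this] obtain r g f c where r: "r \<in> U" and d: "detector U r g f c"
      by blast
    from d have c: "c \<noteq> 0" "0 < dg r" "inj (rho f)" "in_Dsub n f"
      by (auto simp: detector_def slides_def)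
    interpret f: Vector_Spaces.linear sc sc "rho f"
      using rho_linear c by blast
    obtain \<mu> where \<mu>: "\<mu> \<in> T" "r \<in># \<mu>"
      using r by (auto simp: U_def)
    have "0 \<le> wt (\<mu> - {#r#})"
      by (rule wt_nonneg) (use T[OF \<mu>(1)] in \<open>auto dest: in_diffD\<close>)
    then have N: "dg r \<le> int N"
      using T[OF \<mu>(1)] \<mu>(2) by (simp add: wt_remove)
    have sym: "symbol (A g u) (int N - dg r) ((\<lambda>\<mu>. \<mu> - {#r#}) ` {\<mu>\<in>T. r \<in># \<mu>})
      (\<lambda>\<nu>. sc (c * of_nat (Suc (count \<nu> r))) (rho f (p (add_mset r \<nu>))))"
      by (rule detector_symbol[OF d _ less.prems(2)]) (auto simp: U_def)
    show ?thesis
    proof (rule less.IH[of "nat (int N - dg r)" "A g u"])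
      show "nat (int N - dg r) < N"
        using N c by simp
      show "A g u \<in> S"
        using S less.prems by blast
      show "symbol (A g u) (int (nat (int N - dg r))) ((\<lambda>\<mu>. \<mu> - {#r#}) ` {\<mu>\<in>T. r \<in># \<mu>})
        (\<lambda>\<nu>. sc (c * of_nat (Suc (count \<nu> r))) (rho f (p (add_mset r \<nu>))))"
        using sym N by simp
      show "(\<lambda>\<mu>. \<mu> - {#r#}) ` {\<mu>\<in>T. r \<in># \<mu>} \<noteq> {}"
        using \<mu> by blast
    next
      fix \<nu> assume "\<nu> \<in> (\<lambda>\<mu>. \<mu> - {#r#}) ` {\<mu>\<in>T. r \<in># \<mu>}"
      then have "p (add_mset r \<nu>) \<noteq> 0"
        using less.prems(4) by auto
      then have "rho f (p (add_mset r \<nu>)) \<noteq> 0"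
        using c(3) f.zero by (metis injD)
      then show "sc (c * of_nat (Suc (count \<nu> r))) (rho f (p (add_mset r \<nu>))) \<noteq> 0"
        using c(1) by (simp del: of_nat_Suc)
    qed
  qed
qed

lemma exists_symbol:
  assumes "u \<in> F N"
  shows "\<exists>T p. symbol u N T p \<and> (\<forall>\<mu>\<in>T. p \<mu> \<noteq> 0)"
proof -
  \<comment> \<open>Asking \<open>p\<close> to vanish outside \<open>T\<close> lets a monomial be
    inserted without asking whether it is already there; zero coefficients are discarded at the
    end.\<close>
  have "\<exists>T p. symbol u N T p \<and> (\<forall>\<mu>. \<mu> \<notin> T \<longrightarrow> p \<mu> = 0)"
    using assms unfolding F_def
  proof (induction rule: M.span_induct_alt)
    case base
    have "symbol 0 N {} (\<lambda>_. 0)"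
      by (simp add: symbol_def F_closed)
    then show ?case by fast
  next
    case (step a x y)
    then obtain T p where p: "symbol y N T p" "\<forall>\<mu>. \<mu> \<notin> T \<longrightarrow> p \<mu> = 0"
      by blast
    obtain xs v where x: "x = act xs (e v)" "raising (set xs)" "wt (mset xs) \<le> N"
      using step by blast
    show ?case
    proof (cases "wt (mset xs) = N")
      case False
      then have "scm a x \<in> F (N - 1)"
        using x act_in_F F_closed(4) by simp
      moreover have "y - (\<Sum>\<mu>\<in>T. mon \<mu> (p \<mu>)) \<in> F (N - 1)"
        using p by (simp add: symbol_def)
      ultimately have "scm a x + (y - (\<Sum>\<mu>\<in>T. mon \<mu> (p \<mu>))) \<in> F (N - 1)"
        by (rule F_closed)
      then have "symbol (scm a x + y) N T p"
        using p(1) by (simp add: symbol_def add_diff_eq)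
      then show ?thesis
        using p by blast
    next
      case True
      let ?\<mu> = "mset xs"
      let ?T = "insert ?\<mu> T" and ?p = "p(?\<mu> := p ?\<mu> + sc a v)"
      have fin: "finite T"
        using p by (simp add: symbol_def)
      have "(\<Sum>\<mu>\<in>?T. mon \<mu> (?p \<mu>)) = (\<Sum>\<mu>\<in>?T. mon \<mu> (p \<mu>) + (if \<mu> = ?\<mu> then scm a (mon ?\<mu> v) else 0))"
        by (rule sum.cong) (auto simp: mon_add mon_scale)
      also have "\<dots> = (\<Sum>\<mu>\<in>?T. mon \<mu> (p \<mu>)) + scm a (mon ?\<mu> v)"
        using fin by (simp only: sum.distrib sum.delta finite_insert insertI1 if_True)
      also have "(\<Sum>\<mu>\<in>?T. mon \<mu> (p \<mu>)) = (\<Sum>\<mu>\<in>T. mon \<mu> (p \<mu>))"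
        using fin p(2) by (intro sum.mono_neutral_right) auto
      finally have eq: "scm a x + y - (\<Sum>\<mu>\<in>?T. mon \<mu> (?p \<mu>))
          = scm a (x - mon ?\<mu> v) + (y - (\<Sum>\<mu>\<in>T. mon \<mu> (p \<mu>)))"
        by (simp add: M.scale_right_diff_distrib)
      have "x - mon ?\<mu> v \<in> F (N - 1)"
        using act_mon[of xs v] x True by simp
      moreover have "y - (\<Sum>\<mu>\<in>T. mon \<mu> (p \<mu>)) \<in> F (N - 1)"
        using p by (simp add: symbol_def)
      ultimately have "scm a (x - mon ?\<mu> v) + (y - (\<Sum>\<mu>\<in>T. mon \<mu> (p \<mu>))) \<in> F (N - 1)"
        by (intro F_closed(2,4))
      then have "symbol (scm a x + y) N ?T ?p"
        using p(1) x(2) True unfolding symbol_def eq by simp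
      moreover have "\<forall>\<mu>. \<mu> \<notin> ?T \<longrightarrow> ?p \<mu> = 0"
        using p(2) by auto
      ultimately show ?thesis
        by blast
    qed
  qed
  then obtain T p where p: "symbol u N T p"
    by blast
  have "(\<Sum>\<mu>\<in>{\<mu>\<in>T. p \<mu> \<noteq> 0}. mon \<mu> (p \<mu>)) = (\<Sum>\<mu>\<in>T. mon \<mu> (p \<mu>))"
    using p by (intro sum.mono_neutral_left) (auto simp: symbol_def)
  then have "symbol u N {\<mu>\<in>T. p \<mu> \<noteq> 0} p"
    using p unfolding symbol_def by auto
  then show ?thesis by blast
qed

lemma act_in_some_F: "\<exists>N. act xs (e v) \<in> F (int N)"
proof (induction xs)
  case Nil
  have "act [] (e v) \<in> F (int 0)"
    by (rule act_in_F) auto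
  then show ?case ..
next
  case (Cons x xs)
  then obtain N where "act xs (e v) \<in> F (int N)" by blast
  then have "act (x # xs) (e v) \<in> F (int (nat (int N + \<bar>dg x\<bar>)))"
    by (auto intro!: A_in_F)
  then show ?case ..
qed

lemma span_in_some_F:
  assumes "u \<in> M.span {act xs (e v) | xs v. True}"
  shows "\<exists>N. u \<in> F (int N)"
  using assms
proof (induction rule: M.span_induct_alt)
  case base
  then show ?case using F_closed by blast
next
  case (step c x y)
  obtain N N' where "x \<in> F (int N)" "y \<in> F (int N')"
    using step act_in_some_F by blast
  then have "x \<in> F (int (max N N'))" "y \<in> F (int (max N N'))"
    using F_mono[of "int N" "int (max N N')"] F_mono[of "int N'" "int (max N N')"] by auto
  then show ?case
    using F_closed by blast
qed

text \<open>In the least degree \<open>N\<close> whose filtration step contains \<open>u\<close>, a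
  symbol without zero coefficients cannot be empty, since otherwise \<open>u\<close> would lie one
  step lower.\<close>

lemma submodule_meets_image:
  assumes detect: "\<And>U. U \<noteq> {} \<Longrightarrow> raising U \<Longrightarrow> \<exists>r\<in>U. \<exists>g f c. detector U r g f c"
    and S: "\<And>x u. u \<in> S \<Longrightarrow> A x u \<in> S"
    and u: "u \<in> S" "u \<noteq> 0" "u \<in> M.span {act xs (e v) | xs v. True}"
  shows "\<exists>v. v \<noteq> 0 \<and> e v \<in> S"
proof -
  define N where "N = (LEAST N. u \<in> F (int N))"
  have N: "u \<in> F (int N)"
    unfolding N_def using span_in_some_F[OF u(3)] by (rule LeastI_ex)
  have "u \<notin> F (int N - 1)"
  proof (cases N)
    case 0
    then show ?thesis using F_neg u(2) by simp
  next
    case (Suc N')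
    then show ?thesis
      using not_less_Least[of N' "\<lambda>N. u \<in> F (int N)"] by (simp add: N_def)
  qed
  moreover obtain T p where p: "symbol u (int N) T p" "\<forall>\<mu>\<in>T. p \<mu> \<noteq> 0"
    using exists_symbol[OF N] by blast
  ultimately have "T \<noteq> {}"
    by (auto simp: symbol_def)
  then show ?thesis
    using symbol_meets_image[OF detect S u(1) p(1)] p(2) by blast
qed

end

section \<open>Detectors for each kind of variable\<close>

lemma brk_act_single:
  assumes "vector_space sc" "\<And>z. z \<noteq> f \<Longrightarrow> brk x y z = 0"
  shows "brk_act sc rho x y v = sc (brk x y f) (rho f v)"
proof -
  interpret vector_space sc by fact
  have "{z. brk x y z \<noteq> 0} \<subseteq> {f}"
    using assms(2) by blast
  then have "brk_act sc rho x y v = (\<Sum>z\<in>{f}. sc (brk x y z) (rho z v))"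
    unfolding brk_act_def by (intro sum.mono_neutral_left) auto
  then show ?thesis by simp
qed

text \<open>The index r of \<open>h_r\<close> is never 0, so the structure constants in the
  detectors below that involve an h do not vanish.\<close>

lemma half_int_neq_0: "complex_of_int i - 1 / 2 \<noteq> 0"
proof
  assume "complex_of_int i - 1 / 2 = 0"
  then have "complex_of_int (2 * i) = complex_of_int 1"
    by (simp add: mult.commute)
  then have "2 * i = 1"
    by (simp only: of_int_eq_iff)
  then show False
    by presburger
qed

context filtered_action
begin

lemma slides_Dg: "slides (Dg l)"
proof -
  have "dg z < dg r" if "0 < dg r" "brk (Dg l) r z \<noteq> 0" for r z
    using that n_le_k kn_ge l_ge by (cases r) (auto split: if_splits)
  then show ?thesis
    using kn_ge l_ge by (simp add: slides_def)
qed

lemma slides_Hg: "slides (Hg k)"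
proof -
  have "dg z < dg r" if "0 < dg r" "brk (Hg k) r z \<noteq> 0" for r z
    using that n_le_k kn_ge l_ge by (cases r) (auto split: if_splits)
  then show ?thesis
    using kn_ge by (simp add: slides_def)
qed

lemma slides_C2: "slides C2"
  by (simp add: slides_def)

text \<open>With a = - m, the element g is \<open>d_{l+a}\<close>. The bound
  \<open>l \<ge> n + k\<close> pushes its bracket with each \<open>X_b\<close> strictly below the
  critical degree, so the variables \<open>X_b\<close> do not contribute.\<close>

lemma detector_Dg_Dg:
  assumes "l \<ge> n + k" "inj (rho (Dg l))" "raising U" "Dg m \<in> U"
  shows "detector U (Dg m) (Dg (l - m)) (Dg l) (of_int (l - 2 * m))"
proof -
  have m: "m < 0" and l: "0 < l"
    using assms kn_ge by (auto split: if_splits)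
  have "dg z < dg (Dg (l - m)) + dg s" if "s \<in> U" "s \<noteq> Dg m" "brk (Dg (l - m)) s z \<noteq> 0" for s z
  proof -
    have "0 < dg s"
      using that assms(3) by blast
    then show ?thesis
      using that m n_le_k kn_ge assms(1) by (cases s) (auto split: if_splits)
  qed
  moreover have "brk_act scm A (Dg (l - m)) (Dg m) u = scm (of_int (l - 2 * m)) (A (Dg l) u)" for u
    using l by (subst brk_act_single[OF M.vector_space_axioms, of "Dg l"]) auto
  moreover have "complex_of_int (l - 2 * m) \<noteq> 0"
    using l m by (simp only: of_int_eq_0_iff)
  ultimately show ?thesis
    using m l assms(2) slides_Dg by (simp add: detector_def)
qed

text \<open>With a = - m, the element g is \<open>H_{k+a}\<close>. Its bracket with
  \<open>X_b\<close> is nonzero only for b = a + k - n; as \<open>n < k\<close>, this b exceeds a,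
  and the degree 0 of \<open>C2\<close> is below 2(b - a).\<close>

lemma detector_Dg_Hg:
  assumes "n < k" "inj (rho (Hg k))" "raising U" "Dg m \<in> U"
  shows "detector U (Dg m) (Hg (k - m)) (Hg k) (of_int (k - m) - 1 / 2)"
proof -
  have m: "m < 0"
    using assms by (auto split: if_splits)
  have "dg z < dg (Hg (k - m)) + dg s" if "s \<in> U" "s \<noteq> Dg m" "brk (Hg (k - m)) s z \<noteq> 0" for s z
  proof -
    have "0 < dg s"
      using that assms(3) by blast
    then show ?thesis
      using that m n_le_k kn_ge assms(1) by (cases s) (auto split: if_splits)
  qed
  moreover have "brk_act scm A (Hg (k - m)) (Dg m) u = scm (of_int (k - m) - 1 / 2) (A (Hg k) u)" for u
    by (subst brk_act_single[OF M.vector_space_axioms, of "Hg k"]) auto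
  ultimately show ?thesis
    using m n_le_k kn_ge assms(2) slides_Hg half_int_neq_0[of "k - m"] by (simp add: detector_def)
qed

text \<open>For i = 1 - n - a the element g is \<open>d_{l+a}\<close>, since l = n + k - 1. It would
  also act on \<open>Y_a\<close> through \<open>d_l\<close>, hence the exclusion of d's from
  \<open>U\<close>.\<close>

lemma detector_Hg_Dg:
  assumes "l = n + k - 1" "inj (rho (Hg k))" "raising U" "Hg i \<in> U" "\<And>m. Dg m \<notin> U"
  shows "detector U (Hg i) (Dg (k - i)) (Hg k) (- (of_int i - 1 / 2))"
proof -
  have i: "i < 1 - n"
    using assms by (auto split: if_splits)
  have "dg z < dg (Dg (k - i)) + dg s" if "s \<in> U" "s \<noteq> Hg i" "brk (Dg (k - i)) s z \<noteq> 0" for s z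
  proof -
    have "0 < dg s"
      using that assms(3) by blast
    then show ?thesis
      using that i n_le_k kn_ge assms(1,5) by (cases s) (auto split: if_splits)
  qed
  moreover have "brk_act scm A (Dg (k - i)) (Hg i) u = scm (- (of_int i - 1 / 2)) (A (Hg k) u)" for u
    by (subst brk_act_single[OF M.vector_space_axioms, of "Hg k"]) auto
  moreover have "- (complex_of_int i - 1 / 2) \<noteq> 0"
    using half_int_neq_0[of i] by (metis neg_equal_0_iff_equal)
  moreover have "0 < dg (Hg i)" "in_Dsub n (Dg (k - i))" "dg (Dg (k - i)) = - dg (Hg i)"
    using i n_le_k kn_ge assms(1) by auto
  ultimately show ?thesis
    using assms(2) slides_Hg unfolding detector_def by blast
qed

text \<open>Here k = n, so for i = 1 - n - a the element g is \<open>H_{k+a}\<close>, dual to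
  \<open>X_a\<close> under the central bracket. It would also act on \<open>Y_a\<close> through
  \<open>H_k\<close>, hence the exclusion of d's from \<open>U\<close>.\<close>

lemma detector_Hg_Hg:
  assumes "k \<le> n" "inj (rho C2)" "raising U" "Hg i \<in> U" "\<And>m. Dg m \<notin> U"
  shows "detector U (Hg i) (Hg (1 - i)) C2 (of_int (1 - i) - 1 / 2)"
proof -
  have i: "i < 1 - n"
    using assms by (auto split: if_splits)
  have "dg z < dg (Hg (1 - i)) + dg s" if "s \<in> U" "s \<noteq> Hg i" "brk (Hg (1 - i)) s z \<noteq> 0" for s z
    using that assms(3,5) by (cases s) (auto split: if_splits)
  moreover have "brk_act scm A (Hg (1 - i)) (Hg i) u = scm (of_int (1 - i) - 1 / 2) (A C2 u)" for u
    by (subst brk_act_single[OF M.vector_space_axioms, of C2]) auto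
  moreover have "0 < dg (Hg i)" "in_Dsub n (Hg (1 - i))" "dg (Hg (1 - i)) = - dg (Hg i)"
    using i n_le_k kn_ge assms(1) by auto
  ultimately show ?thesis
    using assms(2) slides_C2 half_int_neq_0[of "1 - i"] unfolding detector_def by blast
qed

text \<open>Variables d come first: they are removed by a d if k = n, where l is at least 2n = n +
  k, and by an h if k > n. Once none is left, the roles are exchanged for the variables h.\<close>

lemma exists_detector:
  assumes "inj (rho (Hg k))" "inj (rho C2)"
    and "(k = n \<and> l \<ge> 2 * n \<and> inj (rho (Dg l))) \<or> (k > n \<and> l = n + k - 1)"
    and U: "U \<noteq> {}" "raising U"
  shows "\<exists>r\<in>U. \<exists>g f c. detector U r g f c"
proof (cases "\<exists>m. Dg m \<in> U")
  case True
  then obtain m where m: "Dg m \<in> U" by blast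
  show ?thesis
    using detector_Dg_Dg[OF _ _ U(2) m] detector_Dg_Hg[OF _ _ U(2) m] assms(1,3) m by fastforce
next
  case False
  obtain s where "s \<in> U"
    using U by blast
  then obtain i where i: "Hg i \<in> U"
    using False U(2) by (cases s) auto
  show ?thesis
    using detector_Hg_Dg[OF _ _ U(2) i] detector_Hg_Hg[OF _ _ U(2) i] assms(1-3) False i
    by (metis order_refl)
qed

end

section \<open>Simplicity of the induced module\<close>

text \<open>This realises the quotient E / K as the range of a linear map: a basis of K is extended
  to one of E, and \<open>q\<close> kills the former and fixes the added vectors.\<close>

lemma exists_projection:
  assumes "vector_space sc" "module.subspace sc K" "module.subspace sc E" "K \<subseteq> E"
  obtains q where "Vector_Spaces.linear sc sc q" "\<And>f. q f \<in> E" "\<And>f. f \<in> E \<Longrightarrow> q f - f \<in> K"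
    "\<And>f. f \<in> K \<Longrightarrow> q f = 0"
proof -
  interpret vector_space sc by fact
  interpret vector_space_pair sc sc ..
  obtain B where B: "B \<subseteq> K" "independent B" "K \<subseteq> span B"
    using maximal_independent_subset[of K] by blast
  obtain C where C: "B \<subseteq> C" "C \<subseteq> E" "independent C" "E \<subseteq> span C"
    using maximal_independent_subset_extend[of B E] B assms(4) by blast
  define g where "g b = (if b \<in> C - B then b else 0)" for b
  define q where "q = construct C g"
  interpret q: Vector_Spaces.linear sc sc q
    unfolding q_def by (rule linear_construct[OF C(3)])
  have qC: "q b = g b" if "b \<in> C" for b
    unfolding q_def using construct_basis[OF C(3) that] .
  have "q f \<in> span (g ` C)" for f
    unfolding q_def using construct_in_span[OF C(3)] by blast
  moreover have "span (g ` C) \<subseteq> E"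
    by (rule span_minimal) (use C assms(3) in \<open>auto simp: g_def subspace_0\<close>)
  ultimately have 1: "q f \<in> E" for f by blast
  have 2: "q f - f \<in> K" if "f \<in> E" for f
  proof -
    have "f \<in> span C"
      using that C by blast
    then show ?thesis
    proof (induction rule: span_induct_alt)
      case base
      then show ?case using assms(2) by (simp add: q.zero subspace_0)
    next
      case (step c x y)
      have "q x - x \<in> K"
        using step(1) B(1) assms(2) by (auto simp: qC g_def subspace_0 subspace_neg)
      then have "sc c (q x - x) + (q y - y) \<in> K"
        using step assms(2) by (simp add: subspace_add subspace_scale)
      moreover have "q (sc c x + y) - (sc c x + y) = sc c (q x - x) + (q y - y)"
        by (simp add: q.add q.scale scale_right_diff_distrib)
      ultimately show ?case by metis
    qed
  qed
  have 3: "q f = 0" if "f \<in> K" for f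
  proof -
    have "f \<in> span B"
      using that B by blast
    then show ?thesis
    proof (induction rule: span_induct_alt)
      case (step c x y)
      then have "q x = 0"
        using C(1) qC[of x] by (auto simp: g_def)
      then show ?case
        using step by (simp add: q.add q.scale)
    qed (simp add: q.zero)
  qed
  from q.linear_axioms 1 2 3 show thesis
    by (rule that)
qed

section \<open>Left multiplication modulo the relations\<close>

interpretation lmult: Vector_Spaces.linear fscale fscale "lmult x" for x
  by (rule linear_lmult)

lemma lmult_free_space: "f \<in> free_space \<Longrightarrow> lmult x f \<in> free_space"
  unfolding free_space_def
proof (induction rule: fs.span_induct_alt)
  case base
  then show ?case
    using lmult.zero fs.span_zero by metis
next
  case (step c f g)
  have "lmult x f \<in> fs.span {delta w v |w v. True}"
  proof (rule fs.span_base)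
    show "lmult x f \<in> {delta w v |w v. True}"
    proof -
      obtain w v where "f = delta w v"
        using step(1) by blast
      then have "lmult x f = delta (x # w) v"
        by simp
      then show ?thesis by blast
    qed
  qed
  then show ?case
    unfolding lmult.add lmult.scale using step(2) by (intro fs.span_add fs.span_scale)
qed

lemma ind_relationsI:
  "delta w (sc a v + sc b v') - fscale a (delta w v) - fscale b (delta w v') \<in> ind_relations n sc rho"
  "delta (u @ [x, y] @ t) v - delta (u @ [y, x] @ t) v
     - (\<Sum>z\<in>{z. brk x y z \<noteq> 0}. fscale (brk x y z) (delta (u @ [z] @ t) v)) \<in> ind_relations n sc rho"
  "in_Dsub n p \<Longrightarrow> delta (w @ [p]) v - delta w (rho p v) \<in> ind_relations n sc rho"
  unfolding ind_relations_def by blast+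

lemma lmult_ind_relations:
  assumes "f \<in> ind_relations n sc rho"
  shows "lmult x f \<in> ind_relations n sc rho"
proof -
  consider (lin) w a b v v' where
      "f = delta w (sc a v + sc b v') - fscale a (delta w v) - fscale b (delta w v')"
    | (comm) u y z t v where "f = delta (u @ [y, z] @ t) v - delta (u @ [z, y] @ t) v
        - (\<Sum>a\<in>{a. brk y z a \<noteq> 0}. fscale (brk y z a) (delta (u @ [a] @ t) v))"
    | (mod) w p v where "f = delta (w @ [p]) v - delta w (rho p v)" "in_Dsub n p"
    using assms unfolding ind_relations_def by blast
  then show ?thesis
  proof cases
    case lin
    show ?thesis
      unfolding lin lmult.diff lmult.scale lmult_delta by (rule ind_relationsI)
  next
    case comm
    show ?thesis
      unfolding comm lmult.diff lmult.sum lmult.scale lmult_delta append_Cons[symmetric]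
      by (rule ind_relationsI)
  next
    case mod
    show ?thesis
      unfolding mod(1) lmult.diff lmult_delta append_Cons[symmetric]
      by (rule ind_relationsI) (rule mod)
  qed
qed

lemma lmult_ind_kernel: "f \<in> ind_kernel n sc rho \<Longrightarrow> lmult x f \<in> ind_kernel n sc rho"
  unfolding ind_kernel_def
proof (induction rule: fs.span_induct_alt)
  case base
  then show ?case
    using lmult.zero fs.span_zero by metis
next
  case (step c f g)
  then show ?case
    unfolding lmult.add lmult.scale
    using fs.span_add fs.span_scale fs.span_base[OF lmult_ind_relations] by metis
qed

lemma ind_relations_in_ind_kernel: "f \<in> ind_relations n sc rho \<Longrightarrow> f \<in> ind_kernel n sc rho"
  unfolding ind_kernel_def by (rule fs.span_base)

lemmas ind_kernel_relations = ind_relationsI[THEN ind_relations_in_ind_kernel]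

lemma subspace_ind_kernel: "module.subspace fscale (ind_kernel n sc rho)"
  unfolding ind_kernel_def by (rule fs.subspace_span)

text \<open>On a \<open>delta\<close> this is the commutator relation with empty prefix; the general
  case follows by linearity.\<close>

lemma lmult_commutator:
  assumes "f \<in> free_space"
  shows "lmult x (lmult y f) - lmult y (lmult x f) - brk_act fscale lmult x y f \<in> ind_kernel n sc rho"
  using assms unfolding free_space_def
proof (induction rule: fs.span_induct_alt)
  case base
  have "lmult x (lmult y 0) - lmult y (lmult x 0) - brk_act fscale lmult x y 0 = 0"
    by (simp only: brk_act_def lmult.zero fs.scale_zero_right sum.neutral_const diff_self)
  then show ?case
    using fs.subspace_0[OF subspace_ind_kernel] by metis
next
  case (step c f g)
  let ?c = "\<lambda>f. lmult x (lmult y f) - lmult y (lmult x f) - brk_act fscale lmult x y f"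
  obtain w v where f: "f = delta w v"
    using step(1) by blast
  have "?c f \<in> ind_kernel n sc rho"
    using ind_kernel_relations(2)[where u = "[]" and x = x and y = y and t = w and v = v] by (simp add: f brk_act_def)
  then have "fscale c (?c f) + ?c g \<in> ind_kernel n sc rho"
    using step(2) by (intro fs.subspace_add fs.subspace_scale subspace_ind_kernel)
  moreover have "?c (fscale c f + g) = fscale c (?c f) + ?c g"
    unfolding brk_act_def lmult.add lmult.scale fs.scale_right_distrib fs.scale_right_diff_distrib
      sum.distrib fs.scale_sum_right fs.scale_left_commute[of c]
    by (simp only: algebra_simps)
  ultimately show ?case
    by metis
qed

theorem theorem3p1:
  fixes k n :: int and l :: nat and lev :: complex
    and sc :: "complex \<Rightarrow> 'v \<Rightarrow> 'v::ab_group_add" and rho :: "gen \<Rightarrow> 'v \<Rightarrow> 'v"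
  assumes "k > 0" and "k \<ge> n"
    and "simple_Dsub_module n sc rho"
    and "lev \<noteq> 0" and "\<forall>v. rho C2 v = sc lev v"
    and "inj (rho (Hg k))"
    and "\<forall>i v. i > k \<longrightarrow> rho (Hg i) v = 0"
    and "\<forall>j v. j > int l \<longrightarrow> rho (Dg j) v = 0"
    and "(k = n \<and> int l \<ge> 2 * n \<and> inj (rho (Dg (int l))))
         \<or> (k > n \<and> k + n \<ge> 2 \<and> int l = n + k - 1)"
  shows "induced_module_simple n sc rho"
proof -
  let ?K = "ind_kernel n sc rho"
  have V: "Dsub_module n sc rho" and nz: "(UNIV :: 'v set) \<noteq> {0}"
    and simple: "\<And>W. module.subspace sc W \<Longrightarrow> (\<And>x. in_Dsub n x \<Longrightarrow> rho x ` W \<subseteq> W)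
      \<Longrightarrow> W = {0} \<or> W = UNIV"
    using assms(3) unfolding simple_Dsub_module_def by blast+
  interpret V: vector_space sc
    using V by (simp add: Dsub_module_def)
  obtain q where q: "Vector_Spaces.linear fscale fscale q"
    and q_free: "\<And>f. q f \<in> free_space" and q_diff: "\<And>f. f \<in> free_space \<Longrightarrow> q f - f \<in> ?K"
    and q_K: "\<And>f. f \<in> ?K \<Longrightarrow> q f = 0"
    using exists_projection[OF vector_space_fscale subspace_ind_kernel subspace_free_space
      ind_kernel_subset_free_space] by metis
  interpret q: Vector_Spaces.linear fscale fscale q
    by (rule q)
  have q_cong: "q f = q g" if "f - g \<in> ?K" for f g
    using q_K[OF that] by (simp only: q.diff right_minus_eq)
  \<comment> \<open>The range of \<open>q\<close> models the quotient of the free space by the kernel, so that the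
    relations of the induced module hold for \<open>A\<close> and \<open>e\<close> as equations.\<close>
  define A where "A x f = q (lmult x (q f))" for x f
  define e where "e v = q (delta [] v)" for v
  have A_q: "A x (q f) = q (lmult x f)" if "f \<in> free_space" for x f
  proof -
    have "q (q f) - f = (q (q f) - q f) + (q f - f)"
      by simp
    also have "\<dots> \<in> ?K"
      using q_diff[OF q_free] q_diff[OF that] by (rule fs.subspace_add[OF subspace_ind_kernel])
    finally have "lmult x (q (q f)) - lmult x f \<in> ?K"
      using lmult_ind_kernel by (metis lmult.diff)
    then show ?thesis
      unfolding A_def by (rule q_cong)
  qed
  have A_comm: "A x (A y f) - A y (A x f) = brk_act fscale A x y f" for x y f
  proof -
    have "A x (A y f) - A y (A x f) = q (lmult x (lmult y (q f)) - lmult y (lmult x (q f)))"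
      unfolding A_def[of y f] A_def[of x f] q.diff
      by (simp only: A_q lmult_free_space q_free)
    also have "\<dots> = q (brk_act fscale lmult x y (q f))"
      by (rule q_cong) (rule lmult_commutator[OF q_free])
    also have "\<dots> = brk_act fscale A x y f"
      by (simp only: brk_act_def A_def q.sum q.scale)
    finally show ?thesis .
  qed
  have e_lin: "e (sc a v + sc b v') = fscale a (e v) + fscale b (e v')" for a b v v'
  proof -
    have "e (sc a v + sc b v') = q (fscale a (delta [] v) + fscale b (delta [] v'))"
      unfolding e_def by (rule q_cong) (simp only: diff_diff_add[symmetric] ind_kernel_relations)
    then show ?thesis
      by (simp only: e_def q.add q.scale)
  qed
  interpret filtered_action sc fscale k n "int l" rho A e
  proof (intro filtered_action.intro filtered_action_axioms.intro)
    show "vector_space sc" "vector_space fscale"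
      by (fact V.vector_space_axioms fs.vector_space_axioms)+
    show "n \<le> k" by fact
    \<comment> \<open>If k = n, the first bound comes from k > 0 and the second from l being at
      least 2n.\<close>
    show "2 \<le> k + n" "n + k - 1 \<le> int l"
      using assms(1,9) by auto
    show "Vector_Spaces.linear fscale fscale (A x)" for x
      by unfold_locales (simp_all only: A_def q.add lmult.add q.scale lmult.scale)
    show "A x (A y f) - A y (A x f) = brk_act fscale A x y f" for x y f
      by (rule A_comm)
    show "Vector_Spaces.linear sc fscale e"
    proof
      show "e (v + v') = e v + e v'" for v v'
        using e_lin[of 1 v 1 v'] by (simp only: V.scale_one fs.scale_one)
      show "e (sc a v) = fscale a (e v)" for a v
        using e_lin[of a v 0 0] by (simp only: V.scale_zero_left fs.scale_zero_left add_0_right)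
    qed
    show "A p (e v) = e (rho p v)" if "in_Dsub n p" for p v
      unfolding e_def A_q[OF delta_in_free_space] lmult_delta
      by (rule q_cong) (use ind_kernel_relations(3)[OF that, of "[]"] in simp)
    show "Vector_Spaces.linear sc sc (rho p)" if "in_Dsub n p" for p
      using V that by (simp add: Dsub_module_def)
    show "rho (Hg i) v = 0" if "i > k" for i v
      using assms(7) that by blast
    show "rho (Dg j) v = 0" if "j > int l" for j v
      using assms(8) that by blast
  qed
  have act_e: "act w (e v) = q (delta w v)" for w v
    by (induction w) (simp_all add: e_def A_q)
  have "inj (rho C2)"
    using assms(4,5) by (auto intro!: injI)
  then have detect: "\<exists>r\<in>U. \<exists>g f c. detector U r g f c" if "U \<noteq> {}" "raising U" for U
    using exists_detector[OF assms(6) _ _ that] assms(9) by blast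
  have "S = free_space"
    if S: "module.subspace fscale S" "?K \<subseteq> S" "S \<subseteq> free_space" "\<forall>x. lmult x ` S \<subseteq> S" "S \<noteq> ?K" for S
  proof -
    \<comment> \<open>Since \<open>S\<close> contains the kernel, passing to the representative
      \<open>q f\<close> does not affect membership.\<close>
    have qS: "q f \<in> S \<longleftrightarrow> f \<in> S" if "f \<in> free_space" for f
    proof -
      have d: "q f - f \<in> S"
        using q_diff[OF that] S(2) by blast
      show ?thesis
        using fs.subspace_add[OF S(1) d, of f] fs.subspace_diff[OF S(1) _ d, of "q f"] by auto
    qed
    have lS: "lmult x f \<in> S" if "f \<in> S" for x f
      using S(4) that by blast
    have AS: "A x f \<in> S" if "f \<in> S" for x f
      unfolding A_def using that S(3) qS lS q_free lmult_free_space by (meson subsetD)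
    obtain u where u: "u \<in> S" "u \<notin> ?K"
      using S(2,5) by blast
    have u_free: "u \<in> free_space"
      using u S(3) by blast
    have "q u \<noteq> 0"
    proof
      assume "q u = 0"
      then have "- u \<in> ?K"
        using q_diff[OF u_free] by (simp only: diff_0)
      then show False
        using fs.subspace_neg[OF subspace_ind_kernel] u(2) by (metis minus_minus)
    qed
    moreover have "q u \<in> fs.span {act xs (e v) | xs v. True}"
      using u_free unfolding free_space_def
    proof (induction rule: fs.span_induct_alt)
      case base
      then show ?case
        using q.zero fs.span_zero by metis
    next
      case (step c f g)
      obtain w v where "f = delta w v"
        using step(1) by blast
      then have "q f \<in> fs.span {act xs (e v) | xs v. True}"
        unfolding act_e by (intro fs.span_base) blast
      then show ?case
        unfolding q.add q.scale using step(2) by (intro fs.span_add fs.span_scale)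
    qed
    ultimately obtain v where v: "v \<noteq> 0" "e v \<in> S"
      using submodule_meets_image[OF detect AS, of "q u"] qS[OF u_free] u(1) by blast
    \<comment> \<open>\<open>W\<close> is the intersection of \<open>S\<close> with V, a submodule
      of V that contains the nonzero vector just found; by simplicity it is all of V, and V
      generates the induced module.\<close>
    define W where "W = {v. delta [] v \<in> S}"
    have lin: "sc a v + sc b v' \<in> W" if "v \<in> W" "v' \<in> W" for a b v v'
    proof -
      have "fscale a (delta [] v) + fscale b (delta [] v') \<in> S"
        using that by (auto simp: W_def intro!: fs.subspace_add fs.subspace_scale S(1))
      moreover have "delta [] (sc a v + sc b v') - (fscale a (delta [] v) + fscale b (delta [] v')) \<in> S"
        unfolding diff_diff_add[symmetric] using S(2) ind_kernel_relations(1) by blast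
      ultimately have "(delta [] (sc a v + sc b v') - (fscale a (delta [] v) + fscale b (delta [] v')))
          + (fscale a (delta [] v) + fscale b (delta [] v')) \<in> S"
        using fs.subspace_add[OF S(1)] by blast
      then show ?thesis
        by (simp only: W_def mem_Collect_eq diff_add_cancel)
    qed
    have vW: "v \<in> W"
      using v(2) qS by (simp add: W_def e_def)
    have "V.subspace W"
    proof (rule V.subspaceI)
      show "0 \<in> W"
        using lin[OF vW vW, of 0 0] by simp
      show "x + y \<in> W" if "x \<in> W" "y \<in> W" for x y
        using lin[OF that, of 1 1] by simp
      show "sc c x \<in> W" if "x \<in> W" for c x
        using lin[OF that that, of c 0] by simp
    qed
    moreover have "rho p ` W \<subseteq> W" if "in_Dsub n p" for p
    proof
      fix y assume "y \<in> rho p ` W"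
      then obtain x where x: "delta [] x \<in> S" "y = rho p x"
        by (auto simp: W_def)
      have "delta [p] x \<in> S"
        using lS[OF x(1), of p] by simp
      moreover have "delta [p] x - delta [] (rho p x) \<in> S"
        using ind_kernel_relations(3)[OF that, where w = "[]"] S(2) by auto
      ultimately have "delta [p] x - (delta [p] x - delta [] (rho p x)) \<in> S"
        by (rule fs.subspace_diff[OF S(1)])
      then show "y \<in> W"
        by (simp add: W_def x(2))
    qed
    ultimately have "W = UNIV"
      using simple v(1) vW by blast
    then have "delta [] v \<in> S" for v
      by (auto simp: W_def)
    then have "delta w v \<in> S" for w v
      by (induction w) (auto dest: lS)
    then have "free_space \<subseteq> S"
      unfolding free_space_def by (intro fs.span_minimal S(1)) auto
    then show ?thesis
      using S(3) by blast
  qed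
  then show ?thesis
    using ind_kernel_neq_free_space[OF V nz] unfolding induced_module_simple_def by blast
qed

end
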